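(* The following are equivalent: (i) $p\nmid k_{\mathbf g}$ for every $\mathbf g\in E$ (the factorial scheme is $p'$-valenced); (ii) $\mathbb{T}$ is a semisimple $\mathbb{F}$-algebra; (iii) $E^*_{\mathbf g}\mathbb{T}E^*_{\mathbf g}$ is a semisimple $\mathbb{F}$-algebra for every $\mathbf g\in E$; (iv) $E^*_{\mathbf 1}\mathbb{T}E^*_{\mathbf 1}$ is a semisimple $\mathbb{F}$-algebra; (v) the center $\mathrm{Z}(\mathbb{T})$ is a semisimple $\mathbb{F}$-algebra; (vi) $\mathbb{T}$ is a symmetric $\mathbb{F}$-algebra; (vii) $\mathbb{T}$ is a Frobenius $\mathbb{F}$-algebra; (viii) $\mathbb{T}\cong\bigoplus_{g=1}^{n_\sim}\mathrm{M}_{|\mathbb{D}(g)|}(\mathbb{F})$ as $\mathbb{F}$-algebras. In particular, any one of these conditions holds if and only if $p\nmid\prod_{h=1}^n(|U_h|-1)$.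
   Context: Let $\mathbb{F}$ be a field of characteristic $p\ge 0$; for a positive integer $m$, "$p\mid m$" means that the image of $m$ in $\mathbb{F}$ is zero. Let $n\ge 1$ and let $U_1,\dots,U_n$ be finite sets with $|U_h|\ge 2$. Put $X=U_1\times\cdots\times U_n$ and $E=\{0,1\}^n$; $\mathbf 1$ is the all-one tuple. For $\mathbf g\in E$ let $S(\mathbf g)=\{a:\mathbf g_a=1\}$. For $V\subseteq\{1,\dots,n\}$ let $V^\circ=\{a\in V:|U_a|>2\}$. Let $R_{\mathbf g}=\{(\mathbf y,\mathbf z)\in X\times X:\ \mathbf y_a\neq\mathbf z_a\iff\mathbf g_a=1\}$ (the factorial scheme) and $k_{\mathbf g}=\prod_{a\in S(\mathbf g)}(|U_a|-1)$ ($k_{\mathbf 0}=1$). Let $A_{\mathbf g}\in\mathrm{M}_X(\mathbb{F})$ be the $\{0,1\}$ adjacency matrix of $R_{\mathbf g}$. Fix $\mathbf x\in X$ and let $E^*_{\mathbf g}$ be the diagonal matrix with $(\mathbf y,\mathbf y)$-entry $1$ iff $(\mathbf x,\mathbf y)\in R_{\mathbf g}$, else $0$. $\mathbb{T}$ is the $\mathbb{F}$-subalgebra of $\mathrm{M}_X(\mathbb{F})$ generated by all $A_{\mathbf g},E^*_{\mathbf g}$; $E^*_{\mathbf g}\mathbb{T}E^*_{\mathbf g}$ is an $\mathbb{F}$-algebra with identity $E^*_{\mathbf g}$. Let $\mathbb{P}$ be the set of $(\mathbf a,\mathbf b,\mathbf c)\in E^3$ with $S(\mathbf a)\triangle S(\mathbf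 c)\subseteq S(\mathbf b)\subseteq(S(\mathbf a)\triangle S(\mathbf c))\cup(S(\mathbf a)\cap S(\mathbf c))^\circ$. Let $\mathbb{D}=\{(\mathbf a,\mathbf b,\mathbf c)\in\mathbb{P}: p\nmid k_{\mathbf b}\}$ with equivalence relation $(\mathbf g,\mathbf h,\mathbf i)\sim(\mathbf j,\mathbf k,\mathbf l)$ iff $(S(\mathbf g)\cap S(\mathbf i))^\circ\setminus S(\mathbf h)=(S(\mathbf j)\cap S(\mathbf l))^\circ\setminus S(\mathbf k)$; let $\mathbb{D}_1,\dots,\mathbb{D}_{n_\sim}$ be its classes and $\mathbb{D}(m)=\{\mathbf a\in E: (\mathbf a,\mathbf b,\mathbf a)\in\mathbb{D}_m\text{ for some }\mathbf b\}$. *)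

theory Defs
  imports
    "HOL-Algebra.Module"
    "HOL-Algebra.QuotRing"
    "HOL-Algebra.Subrings"
begin

section \<open>Algebras over a field\<close>

text \<open>
  The scalars form a type of class \<open>field\<close>; an algebra over them is a \<open>module\<close> record.
  The library locale \<open>algebra\<close> is restricted to commutative algebras, hence the following
  version for associative unital algebras that need not be commutative.
\<close>

locale assoc_algebra = ring A for A :: "('f::field, 'a) module" (structure) +
  assumes smult_closed: "x \<in> carrier A \<Longrightarrow> c \<odot> x \<in> carrier A"
    and smult_l_distr: "x \<in> carrier A \<Longrightarrow> (c + d) \<odot> x = c \<odot> x \<oplus> d \<odot> x"
    and smult_r_distr: "\<lbrakk>x \<in> carrier A; y \<in> carrier A\<rbrakk> \<Longrightarrow> c \<odot> (x \<oplus> y) = c \<odot> x \<oplus> c \<odot> y"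
    and smult_assoc1: "x \<in> carrier A \<Longrightarrow> (c * d) \<odot> x = c \<odot> (d \<odot> x)"
    and smult_one: "x \<in> carrier A \<Longrightarrow> 1 \<odot> x = x"
    and smult_mult_l: "\<lbrakk>x \<in> carrier A; y \<in> carrier A\<rbrakk> \<Longrightarrow> (c \<odot> x) \<otimes> y = c \<odot> (x \<otimes> y)"
    and smult_mult_r: "\<lbrakk>x \<in> carrier A; y \<in> carrier A\<rbrakk> \<Longrightarrow> x \<otimes> (c \<odot> y) = c \<odot> (x \<otimes> y)"

definition finite_dim_algebra :: "('f::field, 'a) module \<Rightarrow> bool" where
  "finite_dim_algebra A \<longleftrightarrow>
     assoc_algebra A \<and>
     (\<exists>B. finite B \<and> B \<subseteq> carrier A \<and>
          (\<forall>x \<in> carrier A. \<exists>c. x = (\<Oplus>\<^bsub>A\<^esub> b \<in> B. c b \<odot>\<^bsub>A\<^esub> b)))"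

definition is_subalgebra :: "'a set \<Rightarrow> ('f::field, 'a) module \<Rightarrow> bool" where
  "is_subalgebra B A \<longleftrightarrow> subring B A \<and> (\<forall>c. \<forall>x \<in> B. c \<odot>\<^bsub>A\<^esub> x \<in> B)"

definition generated_subalgebra :: "('f::field, 'a) module \<Rightarrow> 'a set \<Rightarrow> ('f, 'a) module" where
  "generated_subalgebra A G = A\<lparr>carrier := \<Inter>{B. is_subalgebra B A \<and> G \<subseteq> B}\<rparr>"

definition center_algebra :: "('f::field, 'a) module \<Rightarrow> ('f, 'a) module" where
  "center_algebra A =
     A\<lparr>carrier := {z \<in> carrier A. \<forall>x \<in> carrier A. z \<otimes>\<^bsub>A\<^esub> x = x \<otimes>\<^bsub>A\<^esub> z}\<rparr>"

definition corner_algebra :: "('f::field, 'a) module \<Rightarrow> 'a \<Rightarrow> ('f, 'a) module" where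
  "corner_algebra A e =
     A\<lparr>carrier := {e \<otimes>\<^bsub>A\<^esub> x \<otimes>\<^bsub>A\<^esub> e | x. x \<in> carrier A}, one := e\<rparr>"

definition algebra_iso :: "('f::field, 'a) module \<Rightarrow> ('f, 'b) module \<Rightarrow> bool" where
  "algebra_iso A B \<longleftrightarrow>
     (\<exists>\<phi> \<in> ring_iso A B. \<forall>c. \<forall>x \<in> carrier A. \<phi> (c \<odot>\<^bsub>A\<^esub> x) = c \<odot>\<^bsub>B\<^esub> \<phi> x)"

text \<open>The index set is meant to be finite, so that the direct sum is the direct product.\<close>

definition direct_sum_algebra ::
    "'i set \<Rightarrow> ('i \<Rightarrow> ('f::field, 'a) module) \<Rightarrow> ('f, 'i \<Rightarrow> 'a) module" where
  "direct_sum_algebra I A =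
     \<lparr>carrier = (\<Pi>\<^sub>E i \<in> I. carrier (A i)),
      mult = (\<lambda>x y. \<lambda>i \<in> I. x i \<otimes>\<^bsub>A i\<^esub> y i),
      one = (\<lambda>i \<in> I. \<one>\<^bsub>A i\<^esub>),
      zero = (\<lambda>i \<in> I. \<zero>\<^bsub>A i\<^esub>),
      add = (\<lambda>x y. \<lambda>i \<in> I. x i \<oplus>\<^bsub>A i\<^esub> y i),
      smult = (\<lambda>c x. \<lambda>i \<in> I. c \<odot>\<^bsub>A i\<^esub> x i)\<rparr>"

text \<open>Matrices with rows and columns indexed by a finite set, extended by zero.\<close>

definition mat_algebra :: "'x set \<Rightarrow> ('f::field, 'x \<Rightarrow> 'x \<Rightarrow> 'f) module" where
  "mat_algebra X =
     \<lparr>carrier = {M. \<forall>y z. (y, z) \<notin> X \<times> X \<longrightarrow> M y z = 0},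
      mult = (\<lambda>M N y z. \<Sum>w \<in> X. M y w * N w z),
      one = (\<lambda>y z. if y \<in> X \<and> y = z then 1 else 0),
      zero = (\<lambda>y z. 0),
      add = (\<lambda>M N y z. M y z + N y z),
      smult = (\<lambda>c M y z. c * M y z)\<rparr>"


section \<open>Semisimple, Frobenius and symmetric algebras\<close>

definition left_ideal :: "('f::field, 'a) module \<Rightarrow> 'a set \<Rightarrow> bool" where
  "left_ideal A L \<longleftrightarrow>
     additive_subgroup L A \<and> (\<forall>a \<in> carrier A. \<forall>x \<in> L. a \<otimes>\<^bsub>A\<^esub> x \<in> L)"

definition simple_left_ideal :: "('f::field, 'a) module \<Rightarrow> 'a set \<Rightarrow> bool" where
  "simple_left_ideal A L \<longleftrightarrow>
     left_ideal A L \<and> L \<noteq> {\<zero>\<^bsub>A\<^esub>} \<and>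
     (\<forall>K. left_ideal A K \<and> K \<subseteq> L \<longrightarrow> K = {\<zero>\<^bsub>A\<^esub>} \<or> K = L)"

definition left_ideal_sum :: "('f::field, 'a) module \<Rightarrow> 'a set set \<Rightarrow> 'a set" where
  "left_ideal_sum A \<L> = \<Inter>{L. left_ideal A L \<and> \<Union>\<L> \<subseteq> L}"

text \<open>
  Semisimplicity of the left regular module: it is the sum of its simple submodules,
  and these are the simple left ideals.
\<close>

definition semisimple_algebra :: "('f::field, 'a) module \<Rightarrow> bool" where
  "semisimple_algebra A \<longleftrightarrow>
     assoc_algebra A \<and> left_ideal_sum A {L. simple_left_ideal A L} = carrier A"

definition bilinear_form :: "('f::field, 'a) module \<Rightarrow> ('a \<Rightarrow> 'a \<Rightarrow> 'f) \<Rightarrow> bool" where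
  "bilinear_form A \<beta> \<longleftrightarrow>
     (\<forall>x \<in> carrier A. \<forall>y \<in> carrier A. \<forall>z \<in> carrier A.
        \<beta> (x \<oplus>\<^bsub>A\<^esub> y) z = \<beta> x z + \<beta> y z \<and> \<beta> x (y \<oplus>\<^bsub>A\<^esub> z) = \<beta> x y + \<beta> x z) \<and>
     (\<forall>c. \<forall>x \<in> carrier A. \<forall>y \<in> carrier A.
        \<beta> (c \<odot>\<^bsub>A\<^esub> x) y = c * \<beta> x y \<and> \<beta> x (c \<odot>\<^bsub>A\<^esub> y) = c * \<beta> x y)"

definition nondegenerate_form :: "('f::field, 'a) module \<Rightarrow> ('a \<Rightarrow> 'a \<Rightarrow> 'f) \<Rightarrow> bool" where
  "nondegenerate_form A \<beta> \<longleftrightarrow>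
     (\<forall>x \<in> carrier A. (\<forall>y \<in> carrier A. \<beta> x y = 0) \<longrightarrow> x = \<zero>\<^bsub>A\<^esub>) \<and>
     (\<forall>y \<in> carrier A. (\<forall>x \<in> carrier A. \<beta> x y = 0) \<longrightarrow> y = \<zero>\<^bsub>A\<^esub>)"

definition associative_form :: "('f::field, 'a) module \<Rightarrow> ('a \<Rightarrow> 'a \<Rightarrow> 'f) \<Rightarrow> bool" where
  "associative_form A \<beta> \<longleftrightarrow>
     (\<forall>x \<in> carrier A. \<forall>y \<in> carrier A. \<forall>z \<in> carrier A.
        \<beta> (x \<otimes>\<^bsub>A\<^esub> y) z = \<beta> x (y \<otimes>\<^bsub>A\<^esub> z))"

definition frobenius_algebra :: "('f::field, 'a) module \<Rightarrow> bool" where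
  "frobenius_algebra A \<longleftrightarrow>
     finite_dim_algebra A \<and>
     (\<exists>\<beta>. bilinear_form A \<beta> \<and> nondegenerate_form A \<beta> \<and> associative_form A \<beta>)"

definition symmetric_algebra :: "('f::field, 'a) module \<Rightarrow> bool" where
  "symmetric_algebra A \<longleftrightarrow>
     finite_dim_algebra A \<and>
     (\<exists>\<beta>. bilinear_form A \<beta> \<and> nondegenerate_form A \<beta> \<and> associative_form A \<beta> \<and>
          (\<forall>x \<in> carrier A. \<forall>y \<in> carrier A. \<beta> x y = \<beta> y x))"


section \<open>The factorial scheme and its Terwilliger algebra\<close>

definition points :: "nat \<Rightarrow> (nat \<Rightarrow> 'u set) \<Rightarrow> (nat \<Rightarrow> 'u) set" where
  "points n U = (\<Pi>\<^sub>E h \<in> {1..n}. U h)"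

definition tuples :: "nat \<Rightarrow> (nat \<Rightarrow> nat) set" where
  "tuples n = {1..n} \<rightarrow>\<^sub>E {0, 1}"

definition all_one :: "nat \<Rightarrow> nat \<Rightarrow> nat" where
  "all_one n = (\<lambda>a \<in> {1..n}. 1)"

definition supp :: "nat \<Rightarrow> (nat \<Rightarrow> nat) \<Rightarrow> nat set" where
  "supp n g = {a \<in> {1..n}. g a = 1}"

definition circ :: "(nat \<Rightarrow> 'u set) \<Rightarrow> nat set \<Rightarrow> nat set" where
  "circ U V = {a \<in> V. card (U a) > 2}"

definition fact_rel ::
    "nat \<Rightarrow> (nat \<Rightarrow> 'u set) \<Rightarrow> (nat \<Rightarrow> nat) \<Rightarrow> ((nat \<Rightarrow> 'u) \<times> (nat \<Rightarrow> 'u)) set" where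
  "fact_rel n U g =
     {(y, z) \<in> points n U \<times> points n U. \<forall>a \<in> {1..n}. y a \<noteq> z a \<longleftrightarrow> g a = 1}"

definition valency :: "nat \<Rightarrow> (nat \<Rightarrow> 'u set) \<Rightarrow> (nat \<Rightarrow> nat) \<Rightarrow> nat" where
  "valency n U g = (\<Prod>a \<in> supp n g. card (U a) - 1)"

definition adj_mat ::
    "nat \<Rightarrow> (nat \<Rightarrow> 'u set) \<Rightarrow> (nat \<Rightarrow> nat) \<Rightarrow> (nat \<Rightarrow> 'u) \<Rightarrow> (nat \<Rightarrow> 'u) \<Rightarrow> 'f::field" where
  "adj_mat n U g = (\<lambda>y z. if (y, z) \<in> fact_rel n U g then 1 else 0)"

definition dual_idem ::
    "nat \<Rightarrow> (nat \<Rightarrow> 'u set) \<Rightarrow> (nat \<Rightarrow> 'u) \<Rightarrow> (nat \<Rightarrow> nat) \<Rightarrow>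
     (nat \<Rightarrow> 'u) \<Rightarrow> (nat \<Rightarrow> 'u) \<Rightarrow> 'f::field" where
  "dual_idem n U x g = (\<lambda>y z. if y = z \<and> (x, y) \<in> fact_rel n U g then 1 else 0)"

definition terwilliger_algebra ::
    "'f::field itself \<Rightarrow> nat \<Rightarrow> (nat \<Rightarrow> 'u set) \<Rightarrow> (nat \<Rightarrow> 'u) \<Rightarrow>
     ('f, (nat \<Rightarrow> 'u) \<Rightarrow> (nat \<Rightarrow> 'u) \<Rightarrow> 'f) module" where
  "terwilliger_algebra F n U x =
     generated_subalgebra (mat_algebra (points n U))
       (adj_mat n U ` tuples n \<union> dual_idem n U x ` tuples n)"

type_synonym triple = "(nat \<Rightarrow> nat) \<times> (nat \<Rightarrow> nat) \<times> (nat \<Rightarrow> nat)"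

definition triples_P :: "nat \<Rightarrow> (nat \<Rightarrow> 'u set) \<Rightarrow> triple set" where
  "triples_P n U =
     {(a, b, c) \<in> tuples n \<times> tuples n \<times> tuples n.
        sym_diff (supp n a) (supp n c) \<subseteq> supp n b \<and>
        supp n b \<subseteq> sym_diff (supp n a) (supp n c) \<union> circ U (supp n a \<inter> supp n c)}"

definition triples_D :: "'f::field itself \<Rightarrow> nat \<Rightarrow> (nat \<Rightarrow> 'u set) \<Rightarrow> triple set" where
  "triples_D F n U = {(a, b, c) \<in> triples_P n U. (of_nat (valency n U b) :: 'f) \<noteq> 0}"

definition D_rel :: "'f::field itself \<Rightarrow> nat \<Rightarrow> (nat \<Rightarrow> 'u set) \<Rightarrow> (triple \<times> triple) set" where
  "D_rel F n U =
     {((g, h, i), (j, k, l)) \<in> triples_D F n U \<times> triples_D F n U.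
        circ U (supp n g \<inter> supp n i) - supp n h = circ U (supp n j \<inter> supp n l) - supp n k}"

definition D_classes :: "'f::field itself \<Rightarrow> nat \<Rightarrow> (nat \<Rightarrow> 'u set) \<Rightarrow> triple set set" where
  "D_classes F n U = triples_D F n U // D_rel F n U"

definition class_diag :: "nat \<Rightarrow> triple set \<Rightarrow> (nat \<Rightarrow> nat) set" where
  "class_diag n C = {a \<in> tuples n. \<exists>b. (a, b, a) \<in> C}"

end

theory Submission
  imports Defs "HOL-Library.Function_Algebras" "HOL.Vector_Spaces"
begin

text \<open>
  The Terwilliger algebra of the factorial scheme is the tensor product of those of the one-class
  schemes on the sets \<open>U\<^sub>h\<close>, whose elements are the matrices invariant under all permutations
  fixing the base point. If every \<open>m\<^sub>h = |U\<^sub>h| - 1\<close> is invertible in the field, the local algebra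
  is \<open>M\<^sub>2(F)\<close>, plus a copy of \<open>F\<close> if \<open>|U\<^sub>h| > 2\<close>; tensor products of local matrix units are
  matrix units of the whole algebra, and semisimplicity (also of the centre and of the corners),
  the trace form and the decomposition are read off from them. If \<open>m\<^sub>h\<close> vanishes in the field,
  the all-one matrix on \<open>U\<^sub>h\<close> minus the base point, tensored with identity matrices, is a nonzero
  central element of square zero, which survives in the corner at the all-one tuple and
  contradicts semisimplicity; a dimension count for annihilators rules out a Frobenius form.
\<close>

section \<open>Algebras of matrices\<close>

text \<open>Tensor products are never formed abstractly: a tensor is a function of two points given
  by a product of local entries. Distributing a product over sums reduces every identity to five
  coefficients per coordinate, governed by J J = m J for the all-one matrix J on the m = |U_h| - 1
  remaining points: J / m is idempotent if m is invertible, J squares to zero if m vanishes. If all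
  m are invertible, a block is labelled by the set W of coordinates in which the extra copy of the
  field is chosen, and its rows by the tuples a with W \<subseteq> S(a). Its degree is 2^(n - |W|),
  and W is exactly the invariant that separates the classes of triples. If some m vanishes,
  nilpotency alone does not exclude a Frobenius form, since Frobenius algebras such as F[t]/(t^2)
  may have a radical. What fails is duality: locally a four-dimensional space kills a
  two-dimensional one from the left, while in dimension five a nondegenerate associative form allows
  only dimension three. Two-point coordinates shape many statements: there J = I on the single
  remaining point, so one basis element is missing.\<close>

definition mmul :: "'x set \<Rightarrow> ('x \<Rightarrow> 'x \<Rightarrow> 'f::field) \<Rightarrow> ('x \<Rightarrow> 'x \<Rightarrow> 'f) \<Rightarrow> 'x \<Rightarrow> 'x \<Rightarrow> 'f" where
  "mmul X M N = (\<lambda>y z. \<Sum>w \<in> X. M y w * N w z)"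

definition mscale :: "'f::field \<Rightarrow> ('x \<Rightarrow> 'x \<Rightarrow> 'f) \<Rightarrow> 'x \<Rightarrow> 'x \<Rightarrow> 'f" where
  "mscale c M = (\<lambda>y z. c * M y z)"

text \<open>Matrices are total functions, so sum and zero are the type class operations and the
  theory of spans and subspaces applies to sets of matrices directly.\<close>

global_interpretation mat: vector_space "mscale :: 'f::field \<Rightarrow> ('x \<Rightarrow> 'x \<Rightarrow> 'f) \<Rightarrow> _"
  by unfold_locales (auto simp: mscale_def fun_eq_iff algebra_simps)

lemma mscale_apply: "mscale c M y z = c * M y z"
  by (simp add: mscale_def)

lemma sum_fun_apply2: "(\<Sum>i\<in>I. f i) y z = (\<Sum>i\<in>I. f i y z)"
  for f :: "'i \<Rightarrow> 'x \<Rightarrow> 'y \<Rightarrow> 'f::comm_monoid_add"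
  by (induction I rule: infinite_finite_induct) auto

lemma mmul_assoc: "mmul X (mmul X M N) P = mmul X M (mmul X N P)"
proof -
  have "(\<Sum>w\<in>X. (\<Sum>v\<in>X. M y v * N v w) * P w z) = (\<Sum>v\<in>X. M y v * (\<Sum>w\<in>X. N v w * P w z))" for y z
    unfolding sum_distrib_left sum_distrib_right mult.assoc by (rule sum.swap)
  then show ?thesis by (simp add: mmul_def)
qed

lemma mmul_add_left: "mmul X (M + N) P = mmul X M P + mmul X N P"
  and mmul_add_right: "mmul X P (M + N) = mmul X P M + mmul X P N"
  and mmul_mscale_left: "mmul X (mscale c M) P = mscale c (mmul X M P)"
  and mmul_mscale_right: "mmul X P (mscale c M) = mscale c (mmul X P M)"
  and mmul_zero_left: "mmul X 0 P = 0"
  and mmul_zero_right: "mmul X P 0 = 0"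
  by (simp_all add: mmul_def mscale_def fun_eq_iff algebra_simps sum.distrib sum_distrib_left)

lemma mmul_sum_left: "mmul X (\<Sum>i\<in>I. f i) P = (\<Sum>i\<in>I. mmul X (f i) P)"
  unfolding mmul_def fun_eq_iff sum_fun_apply2 sum_distrib_right by (intro allI sum.swap)

lemma mmul_sum_right: "mmul X P (\<Sum>i\<in>I. f i) = (\<Sum>i\<in>I. mmul X P (f i))"
  unfolding mmul_def fun_eq_iff sum_fun_apply2 sum_distrib_left by (intro allI sum.swap)

lemmas mmul_linear = mmul_add_left mmul_add_right mmul_mscale_left mmul_mscale_right
  mmul_zero_left mmul_zero_right mmul_sum_left mmul_sum_right

text \<open>The Terwilliger algebra, its centre and its corners share all operations; only carrier
  and identity vary, hence these two parameters.\<close>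

definition sub_mat ::
    "'x set \<Rightarrow> ('x \<Rightarrow> 'x \<Rightarrow> 'f::field) set \<Rightarrow> ('x \<Rightarrow> 'x \<Rightarrow> 'f) \<Rightarrow> ('f, 'x \<Rightarrow> 'x \<Rightarrow> 'f) module" where
  "sub_mat X C e = \<lparr>carrier = C, mult = mmul X, one = e, zero = 0, add = (+), smult = mscale\<rparr>"

lemma sub_mat_simps [simp]:
  "carrier (sub_mat X C e) = C" "mult (sub_mat X C e) = mmul X" "one (sub_mat X C e) = e"
  "zero (sub_mat X C e) = 0" "add (sub_mat X C e) = (+)" "smult (sub_mat X C e) = mscale"
  by (simp_all add: sub_mat_def)

lemma mat_algebra_eq_sub_mat:
  "mat_algebra X = sub_mat X {M. \<forall>y z. (y, z) \<notin> X \<times> X \<longrightarrow> M y z = 0}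
     (\<lambda>y z. if y \<in> X \<and> y = z then 1 else 0)"
  by (simp add: mat_algebra_def sub_mat_def mmul_def mscale_def fun_eq_iff)

lemma assoc_algebra_sub_mat:
  assumes C: "mat.subspace C" and e: "e \<in> C"
    and m: "\<And>M N. \<lbrakk>M \<in> C; N \<in> C\<rbrakk> \<Longrightarrow> mmul X M N \<in> C"
    and l: "\<And>M. M \<in> C \<Longrightarrow> mmul X e M = M" and r: "\<And>M. M \<in> C \<Longrightarrow> mmul X M e = M"
  shows "assoc_algebra (sub_mat X C e)"
proof (intro assoc_algebra.intro ringI abelian_groupI monoidI assoc_algebra_axioms.intro)
  show "\<exists>y\<in>carrier (sub_mat X C e). y \<oplus>\<^bsub>sub_mat X C e\<^esub> M = \<zero>\<^bsub>sub_mat X C e\<^esub>"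
    if "M \<in> carrier (sub_mat X C e)" for M
    using that C by (auto intro!: bexI[of _ "- M"] mat.subspace_neg)
qed (use assms in \<open>auto simp: mmul_linear mmul_assoc mat.subspace_add mat.subspace_0
  mat.subspace_scale algebra_simps mat.scale_left_distrib mat.scale_right_distrib\<close>)

lemma additive_subgroup_sub_matD:
  assumes "additive_subgroup L (sub_mat X C e)"
  shows "0 \<in> L" "L \<subseteq> C" "\<And>M N. \<lbrakk>M \<in> L; N \<in> L\<rbrakk> \<Longrightarrow> M + N \<in> L"
  using subgroup.one_closed[OF additive_subgroup.a_subgroup[OF assms]]
    subgroup.subset[OF additive_subgroup.a_subgroup[OF assms]]
    subgroup.m_closed[OF additive_subgroup.a_subgroup[OF assms]]
  by auto

text \<open>Closure under negation follows from closure under left multiplication, because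
  \<open>- M\<close> is the product of \<open>mscale (- 1) e\<close> with \<open>M\<close>.\<close>

lemma left_ideal_sub_matI:
  assumes A: "assoc_algebra (sub_mat X C e)" and "L \<subseteq> C" "0 \<in> L"
    and "\<And>M N. \<lbrakk>M \<in> L; N \<in> L\<rbrakk> \<Longrightarrow> M + N \<in> L"
    and m: "\<And>M N. \<lbrakk>M \<in> C; N \<in> L\<rbrakk> \<Longrightarrow> mmul X M N \<in> L"
  shows "left_ideal (sub_mat X C e) L"
proof -
  interpret A: assoc_algebra "sub_mat X C e" by fact
  have one: "e \<in> C" "\<And>M. M \<in> C \<Longrightarrow> mmul X e M = M"
    using A.one_closed A.l_one by simp_all
  have neg: "\<ominus>\<^bsub>sub_mat X C e\<^esub> M = mmul X (mscale (- 1) e) M" if "M \<in> C" for M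
  proof (rule A.minus_equality)
    have "mmul X (mscale (- 1) e) M = - M"
      unfolding mmul_mscale_left using that one by simp
    then show "mmul X (mscale (- 1) e) M \<oplus>\<^bsub>sub_mat X C e\<^esub> M = \<zero>\<^bsub>sub_mat X C e\<^esub>"
      by simp
    show "mmul X (mscale (- 1) e) M \<in> carrier (sub_mat X C e)"
      using A.m_closed[OF A.smult_closed[OF A.one_closed, of "- 1"], of M] that by simp
  qed (use that in auto)
  have "subgroup L (add_monoid (sub_mat X C e))"
  proof (rule A.add.subgroupI)
    fix M assume "M \<in> L"
    moreover have "mscale (- 1) e \<in> C"
      using A.smult_closed[OF A.one_closed, of "- 1"] by simp
    ultimately show "\<ominus>\<^bsub>sub_mat X C e\<^esub> M \<in> L"
      using m neg assms(2) by (auto simp: subset_iff)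
  qed (use assms in auto)
  then show ?thesis
    using m by (auto simp: left_ideal_def additive_subgroup_def)
qed

lemma finsum_sub_mat:
  assumes A: "assoc_algebra (sub_mat X C e)" and "finite I" "\<And>i. i \<in> I \<Longrightarrow> f i \<in> C"
  shows "finsum (sub_mat X C e) f I = (\<Sum>i\<in>I. f i)"
proof -
  interpret A: assoc_algebra "sub_mat X C e" by fact
  show ?thesis using assms(2,3)
  proof (induction I)
    case empty then show ?case by (simp only: A.finsum_empty) simp
  next
    case (insert a I)
    then have "finsum (sub_mat X C e) f (insert a I)
        = f a \<oplus>\<^bsub>sub_mat X C e\<^esub> finsum (sub_mat X C e) f I"
      by (intro A.finsum_insert) auto
    with insert show ?case by simp
  qed
qed

section \<open>Central elements of square zero\<close>

text \<open>For a simple left ideal L, centrality makes zL a left ideal inside L, so zL is zero or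
  L; the second case gives L = zzL = 0. Hence z kills every simple left ideal. The annihilator of z
  is itself a left ideal, so it contains their sum and in particular the identity.\<close>

lemma semisimple_algebra_central_square_zero:
  assumes ss: "semisimple_algebra A" and z: "z \<in> carrier A"
    and central: "\<And>a. a \<in> carrier A \<Longrightarrow> z \<otimes>\<^bsub>A\<^esub> a = a \<otimes>\<^bsub>A\<^esub> z"
    and sq: "z \<otimes>\<^bsub>A\<^esub> z = \<zero>\<^bsub>A\<^esub>"
  shows "z = \<zero>\<^bsub>A\<^esub>"
proof -
  interpret A: assoc_algebra A using ss by (simp add: semisimple_algebra_def)
  define Ann where "Ann = {a \<in> carrier A. z \<otimes>\<^bsub>A\<^esub> a = \<zero>\<^bsub>A\<^esub>}"
  have zm: "z \<otimes>\<^bsub>A\<^esub> (a \<otimes>\<^bsub>A\<^esub> b) = a \<otimes>\<^bsub>A\<^esub> (z \<otimes>\<^bsub>A\<^esub> b)"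
    if "a \<in> carrier A" "b \<in> carrier A" for a b
    using that z central[of a] by (simp flip: A.m_assoc)
  have "subgroup Ann (add_monoid A)"
    by (rule A.add.subgroupI) (use z in \<open>auto simp: Ann_def A.r_distr A.r_minus\<close>)
  then have Ann: "left_ideal A Ann"
    using z by (auto simp: left_ideal_def additive_subgroup_def Ann_def zm)
  have "L \<subseteq> Ann" if "simple_left_ideal A L" for L
  proof -
    from that have L: "additive_subgroup L A" "\<And>a x. \<lbrakk>a \<in> carrier A; x \<in> L\<rbrakk> \<Longrightarrow> a \<otimes>\<^bsub>A\<^esub> x \<in> L"
      "L \<noteq> {\<zero>\<^bsub>A\<^esub>}" and min: "\<And>K. \<lbrakk>left_ideal A K; K \<subseteq> L\<rbrakk> \<Longrightarrow> K = {\<zero>\<^bsub>A\<^esub>} \<or> K = L"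
      by (auto simp: simple_left_ideal_def left_ideal_def)
    interpret L: additive_subgroup L A by fact
    have LA: "x \<in> carrier A" if "x \<in> L" for x using that L.a_subset by auto
    have Lz: "\<zero>\<^bsub>A\<^esub> \<in> L" by simp
    let ?K = "(\<lambda>x. z \<otimes>\<^bsub>A\<^esub> x) ` L"
    have "subgroup ?K (add_monoid A)"
    proof (rule A.add.subgroupI)
      fix k assume "k \<in> ?K"
      then obtain x where x: "x \<in> L" "k = z \<otimes>\<^bsub>A\<^esub> x" by auto
      then have "\<ominus>\<^bsub>A\<^esub> k = z \<otimes>\<^bsub>A\<^esub> (\<ominus>\<^bsub>A\<^esub> x)" using z LA by (simp add: A.r_minus)
      then show "\<ominus>\<^bsub>A\<^esub> k \<in> ?K" using x by auto
    next
      fix k l assume "k \<in> ?K" "l \<in> ?K"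
      then obtain x y where "x \<in> L" "k = z \<otimes>\<^bsub>A\<^esub> x" "y \<in> L" "l = z \<otimes>\<^bsub>A\<^esub> y" by auto
      then show "k \<oplus>\<^bsub>A\<^esub> l \<in> ?K"
        using z LA by (intro image_eqI[of _ _ "x \<oplus>\<^bsub>A\<^esub> y"]) (auto simp: A.r_distr)
    qed (use z LA in \<open>auto intro: Lz\<close>)
    moreover have "a \<otimes>\<^bsub>A\<^esub> k \<in> ?K" if "a \<in> carrier A" "k \<in> ?K" for a k
      using that L(2) by (force simp: zm[symmetric] LA)
    ultimately have "left_ideal A ?K"
      by (auto simp: left_ideal_def additive_subgroup_def)
    moreover have "?K \<subseteq> L" using L(2) z by auto
    ultimately consider "?K = {\<zero>\<^bsub>A\<^esub>}" | "?K = L" using min by blast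
    then have "?K = {\<zero>\<^bsub>A\<^esub>}"
    proof cases
      case 2
      have "x = \<zero>\<^bsub>A\<^esub>" if "x \<in> L" for x
      proof -
        from that 2 obtain y where y: "y \<in> L" "x = z \<otimes>\<^bsub>A\<^esub> y" by auto
        from y 2 obtain w where w: "w \<in> L" "y = z \<otimes>\<^bsub>A\<^esub> w" by auto
        with y have "x = (z \<otimes>\<^bsub>A\<^esub> z) \<otimes>\<^bsub>A\<^esub> w" using z LA by (simp add: A.m_assoc)
        then show ?thesis using sq w LA by simp
      qed
      then have "L = {\<zero>\<^bsub>A\<^esub>}" using Lz by auto
      with L(3) show ?thesis by simp
    qed
    then show ?thesis using LA by (auto simp: Ann_def)
  qed
  then have "left_ideal_sum A {L. simple_left_ideal A L} \<subseteq> Ann"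
    using Ann by (auto simp: left_ideal_sum_def)
  then have "\<one>\<^bsub>A\<^esub> \<in> Ann"
    using ss by (auto simp: semisimple_algebra_def)
  then show ?thesis using z by (simp add: Ann_def)
qed

text \<open>Let E be the elementary matrix with its 1 at (q, p) in summand i. The (p, q) entry of z
  E z is the square of the (p, q) entry of z, while centrality turns z E z into E z z = 0.\<close>

lemma direct_sum_mat_central_square_zero:
  fixes z :: "'i \<Rightarrow> 'd \<Rightarrow> 'd \<Rightarrow> 'f::field" and I D
  defines "S \<equiv> direct_sum_algebra I (\<lambda>i. mat_algebra (D i) :: ('f, 'd \<Rightarrow> 'd \<Rightarrow> 'f) module)"
  assumes fin: "\<And>i. i \<in> I \<Longrightarrow> finite (D i)" and z: "z \<in> carrier S"
    and central: "\<And>a. a \<in> carrier S \<Longrightarrow> z \<otimes>\<^bsub>S\<^esub> a = a \<otimes>\<^bsub>S\<^esub> z"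
    and sq: "z \<otimes>\<^bsub>S\<^esub> z = \<zero>\<^bsub>S\<^esub>"
  shows "z = \<zero>\<^bsub>S\<^esub>"
proof -
  have zz: "z i p q = 0" if "i \<in> I" "p \<in> D i" "q \<in> D i" for i p q
  proof -
    define E :: "'i \<Rightarrow> 'd \<Rightarrow> 'd \<Rightarrow> 'f" where
      "E = (\<lambda>j\<in>I. \<lambda>r s. if j = i \<and> r = q \<and> s = p then 1 else 0)"
    have "E \<in> carrier S"
      using that by (auto simp: S_def direct_sum_algebra_def mat_algebra_def E_def)
    from central[OF this] have "mmul (D i) (z i) (E i) = mmul (D i) (E i) (z i)"
      using that by (auto simp: S_def direct_sum_algebra_def mat_algebra_def mmul_def dest!: fun_cong[of _ _ i])
    moreover have "mmul (D i) (z i) (z i) = 0"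
      using sq that
      by (auto simp: S_def direct_sum_algebra_def mat_algebra_def mmul_def zero_fun_def
        dest!: fun_cong[of _ _ i])
    ultimately have "mmul (D i) (mmul (D i) (z i) (E i)) (z i) p q = 0"
      by (simp add: mmul_assoc mmul_zero_right)
    moreover have "mmul (D i) (z i) (E i) p s = (if s = p then z i p q else 0)" for s
      using that fin[of i] by (simp add: mmul_def E_def if_distrib[of "\<lambda>t. _ * t"] cong: if_cong)
    ultimately have "z i p q * z i p q = 0"
      using that fin[of i] by (simp add: mmul_def[of _ "mmul _ _ _"] if_distrib[of "\<lambda>t. t * _"] cong: if_cong)
    then show ?thesis by simp
  qed
  have "z i = (\<lambda>y z. 0)" if "i \<in> I" for i
  proof (intro ext)
    fix p q show "z i p q = 0"
      using zz[of i p q] z that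
      by (cases "p \<in> D i \<and> q \<in> D i") (auto simp: S_def direct_sum_algebra_def mat_algebra_def PiE_iff)
  qed
  then show ?thesis
    using z by (auto simp: S_def direct_sum_algebra_def mat_algebra_def PiE_iff extensional_def fun_eq_iff)
qed

text \<open>A \<open>ring_iso\<close> preserves sums, products and the identity by definition, but
  its target \<open>S\<close> is not known to be a ring here. The zero of \<open>S\<close> is
  therefore represented by the image of zero.\<close>

lemma ring_iso_central_square_zero:
  assumes \<phi>: "\<phi> \<in> ring_iso A S" and A: "ring A"
    and S: "\<And>y. \<lbrakk>y \<in> carrier S; \<And>a. a \<in> carrier S \<Longrightarrow> y \<otimes>\<^bsub>S\<^esub> a = a \<otimes>\<^bsub>S\<^esub> y; y \<otimes>\<^bsub>S\<^esub> y = \<phi> \<zero>\<^bsub>A\<^esub>\<rbrakk>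
        \<Longrightarrow> y = \<phi> \<zero>\<^bsub>A\<^esub>"
    and z: "z \<in> carrier A" and central: "\<And>a. a \<in> carrier A \<Longrightarrow> z \<otimes>\<^bsub>A\<^esub> a = a \<otimes>\<^bsub>A\<^esub> z"
    and sq: "z \<otimes>\<^bsub>A\<^esub> z = \<zero>\<^bsub>A\<^esub>"
  shows "z = \<zero>\<^bsub>A\<^esub>"
proof -
  interpret A: ring A by fact
  note m = ring_iso_memE[OF \<phi>]
  have "\<phi> z = \<phi> \<zero>\<^bsub>A\<^esub>"
  proof (rule S)
    fix a assume "a \<in> carrier S"
    then obtain b where "b \<in> carrier A" "a = \<phi> b" using m(5) by (auto simp: bij_betw_def)
    then show "\<phi> z \<otimes>\<^bsub>S\<^esub> a = a \<otimes>\<^bsub>S\<^esub> \<phi> z" using m(2) z central by metis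
  qed (use m z sq in \<open>auto simp flip: m(2)\<close>)
  then show ?thesis using m(5) z by (auto simp: bij_betw_def inj_on_def)
qed

lemma ring_iso_direct_sum_mat_central_square_zero:
  fixes A :: "('f::field, 'a) module" and I D
  assumes \<phi>: "\<phi> \<in> ring_iso A (direct_sum_algebra I (\<lambda>i. mat_algebra (D i) :: ('f, 'd \<Rightarrow> 'd \<Rightarrow> 'f) module))"
    and A: "ring A" and fin: "\<And>i. i \<in> I \<Longrightarrow> finite (D i)"
    and z: "z \<in> carrier A" and central: "\<And>a. a \<in> carrier A \<Longrightarrow> z \<otimes>\<^bsub>A\<^esub> a = a \<otimes>\<^bsub>A\<^esub> z"
    and sq: "z \<otimes>\<^bsub>A\<^esub> z = \<zero>\<^bsub>A\<^esub>"
  shows "z = \<zero>\<^bsub>A\<^esub>"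
proof -
  interpret A: ring A by fact
  let ?S = "direct_sum_algebra I (\<lambda>i. mat_algebra (D i) :: ('f, 'd \<Rightarrow> 'd \<Rightarrow> 'f) module)"
  note m = ring_iso_memE[OF \<phi>]
  \<comment> \<open>The image of zero equals its own double; read entrywise in the field, this
    forces it to be the zero family.\<close>
  have "\<phi> \<zero>\<^bsub>A\<^esub> \<oplus>\<^bsub>?S\<^esub> \<phi> \<zero>\<^bsub>A\<^esub> = \<phi> \<zero>\<^bsub>A\<^esub>"
    using m(3)[of "\<zero>\<^bsub>A\<^esub>" "\<zero>\<^bsub>A\<^esub>"] by simp
  then have "(\<lambda>y z. \<phi> \<zero>\<^bsub>A\<^esub> i y z + \<phi> \<zero>\<^bsub>A\<^esub> i y z) = \<phi> \<zero>\<^bsub>A\<^esub> i" if "i \<in> I" for i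
    using that by (auto simp: direct_sum_algebra_def mat_algebra_def dest!: fun_cong[of _ _ i])
  then have dbl: "\<phi> \<zero>\<^bsub>A\<^esub> i y z + \<phi> \<zero>\<^bsub>A\<^esub> i y z = \<phi> \<zero>\<^bsub>A\<^esub> i y z" if "i \<in> I" for i y z
    using that by (auto simp: fun_eq_iff)
  have vanish: "\<phi> \<zero>\<^bsub>A\<^esub> i y z = 0" if "i \<in> I" for i y z
    using dbl[OF that, of y z] by (metis add_cancel_right_right)
  have "\<phi> \<zero>\<^bsub>A\<^esub> \<in> extensional I"
    using m(1)[of "\<zero>\<^bsub>A\<^esub>"] by (simp add: direct_sum_algebra_def PiE_iff)
  then have zero: "\<phi> \<zero>\<^bsub>A\<^esub> = \<zero>\<^bsub>?S\<^esub>"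
    by (rule extensionalityI[where A = I]) (use vanish in \<open>auto simp: direct_sum_algebra_def mat_algebra_def intro!: ext\<close>)
  show ?thesis
  proof (rule ring_iso_central_square_zero[OF \<phi> A _ z central sq])
    fix y assume y: "y \<in> carrier ?S" "\<And>a. a \<in> carrier ?S \<Longrightarrow> y \<otimes>\<^bsub>?S\<^esub> a = a \<otimes>\<^bsub>?S\<^esub> y"
      "y \<otimes>\<^bsub>?S\<^esub> y = \<phi> \<zero>\<^bsub>A\<^esub>"
    have "y = \<zero>\<^bsub>?S\<^esub>"
    proof (rule direct_sum_mat_central_square_zero[of I D y])
      show "finite (D i)" if "i \<in> I" for i using that by (rule fin)
      show "y \<in> carrier ?S" by (rule y(1))
      show "y \<otimes>\<^bsub>?S\<^esub> a = a \<otimes>\<^bsub>?S\<^esub> y" if "a \<in> carrier ?S" for a using that by (rule y(2))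
      show "y \<otimes>\<^bsub>?S\<^esub> y = \<zero>\<^bsub>?S\<^esub>" using y(3) zero by (rule trans)
    qed
    then show "y = \<phi> \<zero>\<^bsub>A\<^esub>" using zero by (rule trans[OF _ sym])
  qed
qed

section \<open>Algebras spanned by matrix units\<close>

lemma sum_mem_closed:
  fixes f :: "'i \<Rightarrow> 'a::comm_monoid_add"
  assumes "\<And>i. i \<in> I \<Longrightarrow> f i \<in> L" "0 \<in> L" "\<And>a b. \<lbrakk>a \<in> L; b \<in> L\<rbrakk> \<Longrightarrow> a + b \<in> L"
  shows "sum f I \<in> L"
  using assms(1) by (induction I rule: infinite_finite_induct) (auto intro: assms(2,3))

text \<open>Linear independence is a consequence of the axioms: by \<open>u_mult\<close>,
  multiplying with units on both sides isolates one coefficient, and \<open>u_nonzero\<close> then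
  determines it. The identity \<open>e\<close> is described by its action only, not as a sum of
  units.\<close>

locale mat_units =
  fixes X :: "'x set" and C :: "('x \<Rightarrow> 'x \<Rightarrow> 'f::field) set" and e :: "'x \<Rightarrow> 'x \<Rightarrow> 'f"
    and B :: "'b set" and D :: "'b \<Rightarrow> 'd set" and u :: "'b \<Rightarrow> 'd \<Rightarrow> 'd \<Rightarrow> 'x \<Rightarrow> 'x \<Rightarrow> 'f"
  assumes fin_B: "finite B" and fin_D: "\<And>b. b \<in> B \<Longrightarrow> finite (D b)"
    and C_eq: "C = mat.span {u b i j | b i j. b \<in> B \<and> i \<in> D b \<and> j \<in> D b}"
    and u_mult: "\<And>b i j b' k l. \<lbrakk>b \<in> B; i \<in> D b; j \<in> D b; b' \<in> B; k \<in> D b'; l \<in> D b'\<rbrakk> \<Longrightarrow>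
      mmul X (u b i j) (u b' k l) = (if b = b' \<and> j = k then u b i l else 0)"
    and u_nonzero: "\<And>b i j. \<lbrakk>b \<in> B; i \<in> D b; j \<in> D b\<rbrakk> \<Longrightarrow> u b i j \<noteq> 0"
    and e_in: "e \<in> C" and e_left: "\<And>M. M \<in> C \<Longrightarrow> mmul X e M = M"
    and e_right: "\<And>M. M \<in> C \<Longrightarrow> mmul X M e = M"
begin

abbreviation "A \<equiv> sub_mat X C e"

definition lc :: "('b \<Rightarrow> 'd \<Rightarrow> 'd \<Rightarrow> 'f) \<Rightarrow> 'x \<Rightarrow> 'x \<Rightarrow> 'f" where
  "lc c = (\<Sum>b\<in>B. \<Sum>i\<in>D b. \<Sum>j\<in>D b. mscale (c b i j) (u b i j))"

lemma subspace_C: "mat.subspace C"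
  by (simp add: C_eq)

lemma u_in: "\<lbrakk>b \<in> B; i \<in> D b; j \<in> D b\<rbrakk> \<Longrightarrow> u b i j \<in> C"
  unfolding C_eq by (rule mat.span_base) blast

lemma lc_in: "lc c \<in> C"
  unfolding lc_def by (intro mat.subspace_sum mat.subspace_scale subspace_C u_in)

lemma lc_add: "lc c + lc d = lc (\<lambda>b i j. c b i j + d b i j)"
  by (simp add: lc_def sum.distrib mat.scale_left_distrib)

lemma lc_scale: "mscale t (lc c) = lc (\<lambda>b i j. t * c b i j)"
  by (simp add: lc_def mat.scale_sum_right)

lemma lc_cong:
  "(\<And>b i j. \<lbrakk>b \<in> B; i \<in> D b; j \<in> D b\<rbrakk> \<Longrightarrow> c b i j = d b i j) \<Longrightarrow> lc c = lc d"
  by (simp add: lc_def)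

lemma u_eq_lc:
  assumes "b \<in> B" "i \<in> D b" "j \<in> D b"
  shows "u b i j = lc (\<lambda>b' i' j'. if b' = b \<and> i' = i \<and> j' = j then 1 else 0)"
proof -
  have "(\<Sum>j'\<in>D b'. mscale (if b' = b \<and> i' = i \<and> j' = j then 1 else 0) (u b' i' j'))
      = (if b' = b then if i' = i then u b i j else 0 else 0)" for b' i'
  proof -
    have "(\<Sum>j'\<in>D b'. mscale (if b' = b \<and> i' = i \<and> j' = j then 1 else 0) (u b' i' j'))
        = (\<Sum>j'\<in>D b'. if j' = j then if b' = b \<and> i' = i then u b i j else 0 else 0)"
      by (intro sum.cong) auto
    also have "\<dots> = (if b' = b then if i' = i then u b i j else 0 else 0)"
      using assms fin_D[of b] by (cases "b' = b") (simp_all add: sum.delta)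
    finally show ?thesis .
  qed
  moreover have "(\<Sum>i'\<in>D b'. if b' = b then if i' = i then u b i j else 0 else 0)
      = (if b' = b then u b i j else 0)" for b'
    using assms fin_D[of b] by (cases "b' = b") (simp_all add: sum.delta)
  ultimately show ?thesis
    using assms fin_B by (simp add: lc_def sum.delta)
qed

lemma lc_surj:
  assumes "M \<in> C"
  obtains c where "M = lc c"
proof -
  have "mat.subspace (range lc)"
  proof (rule mat.subspaceI)
    have "lc (\<lambda>b i j. 0) = 0" by (simp add: lc_def)
    then show "0 \<in> range lc" by (metis rangeI)
  qed (auto simp: lc_add lc_scale)
  moreover have "{u b i j | b i j. b \<in> B \<and> i \<in> D b \<and> j \<in> D b} \<subseteq> range lc"
    using u_eq_lc by blast
  ultimately have "C \<subseteq> range lc"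
    unfolding C_eq by (rule mat.span_minimal[rotated])
  with assms that show ?thesis by blast
qed

lemma u_mult_lc:
  assumes "b \<in> B" "k \<in> D b" "i \<in> D b"
  shows "mmul X (u b k i) (lc c) = (\<Sum>j\<in>D b. mscale (c b i j) (u b k j))"
proof -
  have "mmul X (u b k i) (lc c) = (\<Sum>b'\<in>B. \<Sum>i'\<in>D b'. \<Sum>j'\<in>D b'.
      mscale (c b' i' j') (mmul X (u b k i) (u b' i' j')))"
    by (simp add: lc_def mmul_sum_right mmul_mscale_right)
  also have "\<dots> = (\<Sum>b'\<in>B. \<Sum>i'\<in>D b'. \<Sum>j'\<in>D b'.
      if b' = b then if i' = i then mscale (c b i j') (u b k j') else 0 else 0)"
    using assms by (intro sum.cong refl) (auto simp: u_mult)
  also have "\<dots> = (\<Sum>b'\<in>B. if b' = b then \<Sum>i'\<in>D b. if i' = i then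
      \<Sum>j\<in>D b. mscale (c b i j) (u b k j) else 0 else 0)"
    by (rule sum.cong[OF refl]) (auto intro!: sum.cong)
  also have "\<dots> = (\<Sum>j\<in>D b. mscale (c b i j) (u b k j))"
    using assms fin_B fin_D[of b] by (simp add: sum.delta)
  finally show ?thesis .
qed

lemma lc_mult_u:
  assumes "b \<in> B" "j \<in> D b" "l \<in> D b"
  shows "mmul X (lc c) (u b j l) = (\<Sum>i\<in>D b. mscale (c b i j) (u b i l))"
proof -
  have "mmul X (lc c) (u b j l) = (\<Sum>b'\<in>B. \<Sum>i'\<in>D b'. \<Sum>j'\<in>D b'.
      mscale (c b' i' j') (mmul X (u b' i' j') (u b j l)))"
    by (simp add: lc_def mmul_sum_left mmul_mscale_left)
  also have "\<dots> = (\<Sum>b'\<in>B. \<Sum>i'\<in>D b'. \<Sum>j'\<in>D b'.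
      if j' = j then if b' = b then mscale (c b i' j) (u b i' l) else 0 else 0)"
    using assms by (intro sum.cong refl) (auto simp: u_mult)
  also have "\<dots> = (\<Sum>b'\<in>B. if b' = b then \<Sum>i\<in>D b. mscale (c b i j) (u b i l) else 0)"
    using assms fin_D[of b] by (intro sum.cong[OF refl]) (auto simp: sum.delta intro!: sum.neutral)
  also have "\<dots> = (\<Sum>i\<in>D b. mscale (c b i j) (u b i l))"
    using assms fin_B by (simp add: sum.delta)
  finally show ?thesis .
qed

text \<open>This sandwich is the main computing device: it yields uniqueness of coefficients,
  simplicity of the columns, the shape of central elements and the idempotence needed for
  corners.\<close>

lemma u_lc_u:
  assumes "b \<in> B" "k \<in> D b" "i \<in> D b" "j \<in> D b" "l \<in> D b"
  shows "mmul X (mmul X (u b k i) (lc c)) (u b j l) = mscale (c b i j) (u b k l)"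
proof -
  have "mmul X (mmul X (u b k i) (lc c)) (u b j l)
      = (\<Sum>j'\<in>D b. mscale (c b i j') (mmul X (u b k j') (u b j l)))"
    using assms by (simp add: u_mult_lc mmul_sum_left mmul_mscale_left)
  also have "\<dots> = (\<Sum>j'\<in>D b. if j' = j then mscale (c b i j) (u b k l) else 0)"
    using assms by (intro sum.cong) (auto simp: u_mult)
  also have "\<dots> = mscale (c b i j) (u b k l)"
    using assms fin_D[of b] by (simp add: sum.delta)
  finally show ?thesis .
qed

lemma lc_inj:
  assumes "lc c = lc d" "b \<in> B" "i \<in> D b" "j \<in> D b"
  shows "c b i j = d b i j"
proof -
  have "mscale (c b i j) (u b i j) = mscale (d b i j) (u b i j)"
    using u_lc_u[of b i i j j c] u_lc_u[of b i i j j d] assms by metis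
  then show ?thesis
    using u_nonzero[OF assms(2-4)] by simp
qed

lemma lc_mult: "mmul X (lc c) (lc d) = lc (\<lambda>b i l. \<Sum>j\<in>D b. c b i j * d b j l)"
proof -
  have "mmul X (lc c) (lc d) = (\<Sum>b\<in>B. \<Sum>i\<in>D b. \<Sum>j\<in>D b. mscale (c b i j) (mmul X (u b i j) (lc d)))"
    by (simp add: lc_def[of c] mmul_sum_left mmul_mscale_left)
  also have "\<dots> = (\<Sum>b\<in>B. \<Sum>i\<in>D b. \<Sum>j\<in>D b. \<Sum>l\<in>D b. mscale (c b i j * d b j l) (u b i l))"
    by (intro sum.cong refl) (simp add: u_mult_lc mat.scale_sum_right)
  also have "\<dots> = (\<Sum>b\<in>B. \<Sum>i\<in>D b. \<Sum>l\<in>D b. \<Sum>j\<in>D b. mscale (c b i j * d b j l) (u b i l))"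
    by (rule sum.cong[OF refl], rule sum.cong[OF refl], rule sum.swap)
  also have "\<dots> = lc (\<lambda>b i l. \<Sum>j\<in>D b. c b i j * d b j l)"
    by (simp add: lc_def mat.scale_sum_left)
  finally show ?thesis .
qed

lemma mult_in: "\<lbrakk>M \<in> C; N \<in> C\<rbrakk> \<Longrightarrow> mmul X M N \<in> C"
  by (elim lc_surj) (simp add: lc_mult lc_in)

lemma assoc_algebra_A: "assoc_algebra A"
  by (intro assoc_algebra_sub_mat subspace_C e_in mult_in e_left e_right)

text \<open>Column \<open>j\<close> of block \<open>b\<close> is minimal because a nonzero
  \<open>N\<close> in it has some coefficient \<open>c b i j \<noteq> 0\<close>; multiplying by
  \<open>u b j i\<close> and rescaling yields \<open>u b j j\<close>, which generates the
  column.\<close>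

lemma simple_left_ideal_column:
  assumes b: "b \<in> B" "j \<in> D b"
  shows "simple_left_ideal A ((\<lambda>M. mmul X M (u b j j)) ` C)"
proof -
  let ?L = "(\<lambda>M. mmul X M (u b j j)) ` C"
  have uL: "u b j j \<in> ?L"
    using u_mult[of b j j b j j] b u_in[of b j j] by (auto intro!: image_eqI[of _ _ "u b j j"])
  have L: "left_ideal A ?L"
  proof (rule left_ideal_sub_matI[OF assoc_algebra_A])
    show "?L \<subseteq> C" using b by (auto intro: mult_in u_in)
    show "0 \<in> ?L"
      using mat.subspace_0[OF subspace_C] by (auto intro!: image_eqI[of _ _ 0] simp: mmul_zero_left)
    show "M + N \<in> ?L" if "M \<in> ?L" "N \<in> ?L" for M N
      using that mat.subspace_add[OF subspace_C] by (auto simp flip: mmul_add_left)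
    show "mmul X M N \<in> ?L" if "M \<in> C" "N \<in> ?L" for M N
      using that mult_in by (auto simp flip: mmul_assoc)
  qed
  have "K = {0} \<or> K = ?L" if K: "left_ideal A K" "K \<subseteq> ?L" for K
  proof (cases "K \<subseteq> {0}")
    case True
    moreover have "0 \<in> K" using K(1) additive_subgroup_sub_matD(1) by (auto simp: left_ideal_def)
    ultimately show ?thesis by blast
  next
    case False
    then obtain N where N: "N \<in> K" "N \<noteq> 0" by auto
    with K obtain M where "M \<in> C" "N = mmul X M (u b j j)" by auto
    moreover then obtain c where c: "M = lc c" by (auto elim: lc_surj)
    ultimately have Neq: "N = (\<Sum>i\<in>D b. mscale (c b i j) (u b i j))"
      using lc_mult_u b by simp
    have "\<exists>i\<in>D b. c b i j \<noteq> 0"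
    proof (rule ccontr)
      assume "\<not> ?thesis" then have "N = 0" unfolding Neq by (intro sum.neutral) auto
      with N show False by simp
    qed
    then obtain i where i: "i \<in> D b" "c b i j \<noteq> 0" by blast
    have "mmul X (u b j i) N = mscale (c b i j) (u b j j)"
      using u_lc_u[of b j i j j c] b i \<open>N = mmul X M (u b j j)\<close> c by (simp add: mmul_assoc)
    then have "mmul X (mscale (inverse (c b i j)) (u b j i)) N = u b j j"
      using i by (simp add: mmul_mscale_left)
    moreover have "mscale (inverse (c b i j)) (u b j i) \<in> C"
      using b i by (intro mat.subspace_scale subspace_C u_in)
    ultimately have "u b j j \<in> K"
      using K(1) N by (force simp: left_ideal_def)
    then have "?L \<subseteq> K" using K(1) by (auto simp: left_ideal_def)
    with K show ?thesis by blast
  qed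
  then show ?thesis
    unfolding simple_left_ideal_def using L uL u_nonzero[of b j j] b by auto
qed

text \<open>Each unit \<open>u b i j\<close> equals \<open>u b i j\<close> times
  \<open>u b j j\<close> and so lies in a simple column; hence every linear combination of units
  lies in the sum of the simple left ideals.\<close>

theorem semisimple: "semisimple_algebra A"
proof -
  have "carrier A \<subseteq> L" if L: "left_ideal A L" "\<Union>{L. simple_left_ideal A L} \<subseteq> L" for L
  proof
    fix M assume "M \<in> carrier A"
    then obtain c where M: "M = lc c" by (auto elim: lc_surj)
    have add: "0 \<in> L" "\<And>M N. M \<in> L \<Longrightarrow> N \<in> L \<Longrightarrow> M + N \<in> L"
      using L(1) additive_subgroup_sub_matD by (auto simp: left_ideal_def)
    have sum: "sum f I \<in> L" if "\<And>i. i \<in> I \<Longrightarrow> f i \<in> L" for f :: "'i \<Rightarrow> 'x \<Rightarrow> 'x \<Rightarrow> 'f" and I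
      using that add by (rule sum_mem_closed)
    have "mscale (c b i j) (u b i j) \<in> L" if "b \<in> B" "i \<in> D b" "j \<in> D b" for b i j
    proof -
      have "mmul X (mscale (c b i j) (u b i j)) (u b j j) = mscale (c b i j) (u b i j)"
        using that by (simp add: mmul_mscale_left u_mult)
      moreover have "mscale (c b i j) (u b i j) \<in> C"
        using that by (intro mat.subspace_scale subspace_C u_in)
      ultimately have "mscale (c b i j) (u b i j) \<in> (\<lambda>M. mmul X M (u b j j)) ` C"
        by (metis imageI)
      then show ?thesis using simple_left_ideal_column[of b j] that L(2) by blast
    qed
    then show "M \<in> L" unfolding M lc_def by (intro sum)
  qed
  moreover have "left_ideal A (carrier A)"
    by (rule left_ideal_sub_matI[OF assoc_algebra_A])
      (use mult_in mat.subspace_add[OF subspace_C] mat.subspace_0[OF subspace_C] in auto)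
  moreover have "L \<subseteq> carrier A" if "simple_left_ideal A L" for L
    using that additive_subgroup_sub_matD(2) by (fastforce simp: simple_left_ideal_def left_ideal_def)
  ultimately show ?thesis
    unfolding semisimple_algebra_def left_ideal_sum_def using assoc_algebra_A by blast
qed

text \<open>The values outside the index sets (zero inside a block of \<open>B\<close>,
  \<open>undefined\<close> off \<open>B\<close>) are those demanded by the carrier of
  \<open>direct_sum_algebra\<close>, so \<open>coord\<close> itself can serve as the
  isomorphism.\<close>

definition coord :: "('x \<Rightarrow> 'x \<Rightarrow> 'f) \<Rightarrow> 'b \<Rightarrow> 'd \<Rightarrow> 'd \<Rightarrow> 'f" where
  "coord M = (\<lambda>b\<in>B. \<lambda>i j. if i \<in> D b \<and> j \<in> D b then (SOME c. M = lc c) b i j else 0)"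

lemma lc_coord: "M \<in> C \<Longrightarrow> lc (coord M) = M"
proof -
  assume "M \<in> C"
  then obtain c where "M = lc c" by (rule lc_surj)
  then have "M = lc (SOME c. M = lc c)" by (rule someI[of "\<lambda>c. M = lc c"])
  moreover have "lc (coord M) = lc (SOME c. M = lc c)" by (rule lc_cong) (simp add: coord_def)
  ultimately show ?thesis by simp
qed

lemma coord_lc: "\<lbrakk>b \<in> B; i \<in> D b; j \<in> D b\<rbrakk> \<Longrightarrow> coord (lc c) b i j = c b i j"
  using lc_inj lc_coord[OF lc_in] by metis

lemma coord_outside: "\<lbrakk>b \<in> B; \<not> (i \<in> D b \<and> j \<in> D b)\<rbrakk> \<Longrightarrow> coord M b i j = 0"
  by (auto simp: coord_def)

lemma coord_add:
  "\<lbrakk>M \<in> C; N \<in> C; b \<in> B; i \<in> D b; j \<in> D b\<rbrakk> \<Longrightarrow> coord (M + N) b i j = coord M b i j + coord N b i j"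
  using coord_lc[of b i j "\<lambda>b i j. coord M b i j + coord N b i j"] by (simp add: lc_coord flip: lc_add)

lemma coord_scale:
  "\<lbrakk>M \<in> C; b \<in> B; i \<in> D b; j \<in> D b\<rbrakk> \<Longrightarrow> coord (mscale t M) b i j = t * coord M b i j"
  using coord_lc[of b i j "\<lambda>b i j. t * coord M b i j"] by (simp add: lc_coord flip: lc_scale)

lemma coord_mult:
  "\<lbrakk>M \<in> C; N \<in> C; b \<in> B; i \<in> D b; j \<in> D b\<rbrakk> \<Longrightarrow>
     coord (mmul X M N) b i j = (\<Sum>k\<in>D b. coord M b i k * coord N b k j)"
  using coord_lc[of b i j "\<lambda>b i j. \<Sum>k\<in>D b. coord M b i k * coord N b k j"]
  by (simp add: lc_coord flip: lc_mult)

theorem iso_direct_sum: "algebra_iso A (direct_sum_algebra B (\<lambda>b. mat_algebra (D b)))"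
proof -
  let ?S = "direct_sum_algebra B (\<lambda>b. mat_algebra (D b)) :: ('f, 'b \<Rightarrow> 'd \<Rightarrow> 'd \<Rightarrow> 'f) module"
  note S = direct_sum_algebra_def mat_algebra_def
  have carr: "coord M \<in> carrier ?S" for M
    by (auto simp: S coord_def)
  have eq: "coord M = c"
    if "c \<in> carrier ?S" "\<And>b i j. \<lbrakk>b \<in> B; i \<in> D b; j \<in> D b\<rbrakk> \<Longrightarrow> coord M b i j = c b i j" for M c
  proof (intro ext)
    fix b i j
    have "b \<notin> B \<Longrightarrow> c b = undefined" "\<lbrakk>b \<in> B; \<not> (i \<in> D b \<and> j \<in> D b)\<rbrakk> \<Longrightarrow> c b i j = 0"
      using that(1) by (auto simp: S PiE_iff extensional_def)
    then show "coord M b i j = c b i j"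
      using that(2) coord_outside[of b i j M]
      by (cases "b \<in> B"; cases "i \<in> D b \<and> j \<in> D b") (auto simp: coord_def)
  qed
  have mult: "coord (mmul X M N) = coord M \<otimes>\<^bsub>?S\<^esub> coord N" if "M \<in> C" "N \<in> C" for M N
    by (rule eq) (use that in \<open>auto simp: S coord_mult coord_outside intro!: sum.neutral\<close>)
  have add: "coord (M + N) = coord M \<oplus>\<^bsub>?S\<^esub> coord N" if "M \<in> C" "N \<in> C" for M N
    by (rule eq) (use that in \<open>auto simp: S coord_add coord_outside\<close>)
  have scale: "coord (mscale t M) = t \<odot>\<^bsub>?S\<^esub> coord M" if "M \<in> C" for t M
    by (rule eq) (use that in \<open>auto simp: S coord_scale coord_outside\<close>)
  have bij: "bij_betw coord (carrier A) (carrier ?S)"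
  proof (rule bij_betw_byWitness[of _ lc])
    show "\<forall>c\<in>carrier ?S. coord (lc c) = c" using eq coord_lc by blast
  qed (use lc_coord lc_in carr in auto)
  \<comment> \<open>No expansion of \<open>e\<close> into units is at hand. Instead a preimage
    \<open>M\<close> of the identity family is taken: \<open>M\<close> has identity coordinates, so
    \<open>e\<close> and the product of \<open>e\<close> with \<open>M\<close> have the same
    coordinates, and that product is \<open>M\<close>.\<close>
  have one: "coord e = \<one>\<^bsub>?S\<^esub>"
  proof -
    have "\<one>\<^bsub>?S\<^esub> \<in> carrier ?S" by (auto simp: S)
    then have "\<one>\<^bsub>?S\<^esub> \<in> coord ` C" using bij by (auto simp: bij_betw_def)
    then obtain M where M: "M \<in> C" "coord M = \<one>\<^bsub>?S\<^esub>" by force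
    have "coord e = coord (mmul X e M)"
    proof (rule eq[OF carr])
      fix b i j assume b: "b \<in> B" "i \<in> D b" "j \<in> D b"
      have "coord (mmul X e M) b i j = (\<Sum>k\<in>D b. coord e b i k * (if k = j then 1 else 0))"
        using b M e_in by (simp add: coord_mult S cong: sum.cong)
      also have "\<dots> = coord e b i j"
        using b fin_D[of b] by (simp add: if_distrib[of "\<lambda>t. _ * t"] cong: if_cong)
      finally show "coord e b i j = coord (mmul X e M) b i j" by simp
    qed
    with M e_left show ?thesis by simp
  qed
  have "coord \<in> ring_iso A ?S"
    by (rule ring_iso_memI) (use carr mult add one bij in auto)
  then show ?thesis unfolding algebra_iso_def using scale by auto
qed

lemma finite_dim: "finite_dim_algebra A"
proof -
  define I where "I = (SIGMA b:B. D b \<times> D b)"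
  define w where "w = (\<lambda>(b, i, j). u b i j)"
  have finI: "finite I" using fin_B fin_D by (auto simp: I_def)
  have w: "w ` I \<subseteq> C" by (auto simp: I_def w_def u_in)
  have "\<exists>c. M = (\<Oplus>\<^bsub>A\<^esub> b\<in>w ` I. c b \<odot>\<^bsub>A\<^esub> b)" if "M \<in> C" for M
  proof -
    from that obtain c where c: "M = lc c" by (rule lc_surj)
    define c' where "c' = (\<lambda>(b, i, j). c b i j)"
    have "M = (\<Sum>t\<in>I. mscale (c' t) (w t))"
      using fin_B fin_D unfolding c lc_def I_def c'_def w_def
      by (simp add: sum.Sigma split_def sum.cartesian_product)
    also have "\<dots> = (\<Sum>v\<in>w ` I. \<Sum>t\<in>{t \<in> I. w t = v}. mscale (c' t) (w t))"
      using finI by (rule sum.image_gen)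
    also have "\<dots> = (\<Sum>v\<in>w ` I. mscale (\<Sum>t\<in>{t \<in> I. w t = v}. c' t) v)"
      by (intro sum.cong refl) (auto simp: mat.scale_sum_left)
    also have "\<dots> = (\<Oplus>\<^bsub>A\<^esub> v\<in>w ` I. (\<Sum>t\<in>{t \<in> I. w t = v}. c' t) \<odot>\<^bsub>A\<^esub> v)"
      using w finI mat.subspace_scale[OF subspace_C]
      by (subst finsum_sub_mat[OF assoc_algebra_A]) (auto simp: subset_iff)
    finally show ?thesis by (rule exI[of _ "\<lambda>v. \<Sum>t\<in>{t \<in> I. w t = v}. c' t"])
  qed
  then show ?thesis
    unfolding finite_dim_algebra_def using assoc_algebra_A w finI
    by (intro conjI exI[of _ "w ` I"]) auto
qed

theorem symmetric: "symmetric_algebra A"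
proof -
  \<comment> \<open>The sum over the blocks of the trace of the product. The trace of
    \<open>X\<close>-indexed matrices would not do: the local idempotent I - J / m has trace m - 1
    there, which may vanish in the field.\<close>
  define \<beta> where "\<beta> M N = (\<Sum>b\<in>B. \<Sum>i\<in>D b. \<Sum>j\<in>D b. coord M b i j * coord N b j i)" for M N
  have sym: "\<beta> M N = \<beta> N M" for M N
  proof -
    have "\<beta> M N = (\<Sum>b\<in>B. \<Sum>j\<in>D b. \<Sum>i\<in>D b. coord M b i j * coord N b j i)"
      unfolding \<beta>_def by (rule sum.cong[OF refl], rule sum.swap)
    then show ?thesis by (simp add: \<beta>_def mult.commute)
  qed
  have assoc: "\<beta> (mmul X M N) P = \<beta> M (mmul X N P)" if "M \<in> C" "N \<in> C" "P \<in> C" for M N P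
  proof -
    have "\<beta> (mmul X M N) P
        = (\<Sum>b\<in>B. \<Sum>i\<in>D b. \<Sum>j\<in>D b. \<Sum>k\<in>D b. coord M b i k * coord N b k j * coord P b j i)"
      unfolding \<beta>_def using that by (intro sum.cong refl) (simp add: coord_mult sum_distrib_right)
    also have "\<dots> = (\<Sum>b\<in>B. \<Sum>i\<in>D b. \<Sum>k\<in>D b. \<Sum>j\<in>D b. coord M b i k * coord N b k j * coord P b j i)"
      by (rule sum.cong[OF refl], rule sum.cong[OF refl], rule sum.swap)
    also have "\<dots> = \<beta> M (mmul X N P)"
      unfolding \<beta>_def using that
      by (intro sum.cong refl) (simp add: coord_mult sum_distrib_left mult.assoc)
    finally show ?thesis .
  qed
  have add: "\<beta> (M + N) P = \<beta> M P + \<beta> N P" if "M \<in> C" "N \<in> C" for M N P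
    using that by (simp add: \<beta>_def coord_add sum.distrib distrib_right)
  have scale: "\<beta> (mscale t M) P = t * \<beta> M P" if "M \<in> C" for t M P
    using that by (simp add: \<beta>_def coord_scale sum_distrib_left mult.assoc)
  have add': "\<beta> P (M + N) = \<beta> P M + \<beta> P N" if "M \<in> C" "N \<in> C" for M N P
    using add[OF that, of P] by (simp only: sym[of P])
  have scale': "\<beta> P (mscale t M) = t * \<beta> P M" if "M \<in> C" for t M P
    using scale[OF that, of t P] by (simp only: sym[of P])
  \<comment> \<open>Pairing with the transposed unit reads off one coordinate; nondegeneracy
    follows.\<close>
  have unit: "\<beta> M (u b j i) = coord M b i j" if b: "b \<in> B" "i \<in> D b" "j \<in> D b" for M b i j
  proof -
    have "\<beta> M (u b j i) = (\<Sum>b'\<in>B. \<Sum>i'\<in>D b'. \<Sum>j'\<in>D b'.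
        if j' = j then if b' = b then if i' = i then coord M b i j else 0 else 0 else 0)"
      unfolding \<beta>_def by (intro sum.cong refl) (auto simp: u_eq_lc[OF b(1) b(3) b(2)] coord_lc)
    also have "\<dots> = (\<Sum>b'\<in>B. if b' = b then \<Sum>i'\<in>D b. if i' = i then coord M b i j else 0 else 0)"
      using b fin_D[of b] by (intro sum.cong[OF refl]) (auto simp: sum.delta intro!: sum.neutral)
    also have "\<dots> = coord M b i j"
      using b fin_B fin_D[of b] by (simp add: sum.delta)
    finally show ?thesis .
  qed
  have nondeg: "M = 0" if "M \<in> C" "\<forall>N\<in>C. \<beta> M N = 0" for M
  proof -
    have "coord M b i j = 0" if "b \<in> B" "i \<in> D b" "j \<in> D b" for b i j
      using unit[of b i j M] u_in[of b j i] that \<open>\<forall>N\<in>C. \<beta> M N = 0\<close> by simp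
    then have "lc (coord M) = 0" by (simp add: lc_def)
    then show ?thesis using lc_coord that by simp
  qed
  have "bilinear_form A \<beta>"
    unfolding bilinear_form_def sub_mat_simps using add scale add' scale' by blast
  moreover have "nondegenerate_form A \<beta>"
    unfolding nondegenerate_form_def using nondeg sym by simp
  moreover have "associative_form A \<beta>"
    unfolding associative_form_def using assoc by simp
  ultimately show ?thesis
    unfolding symmetric_algebra_def using finite_dim sym by blast
qed

text \<open>The centre is spanned by the block identities \<open>z b\<close>. These are orthogonal
  idempotents, that is, matrix units of blocks of degree one, so the locale applies again with the
  index type \<open>unit\<close>.\<close>

theorem semisimple_center: "semisimple_algebra (center_algebra A)"
proof -
  \<comment> \<open>An empty block has block identity zero, which would violate the nonvanishing of
    units.\<close>
  define B' where "B' = {b \<in> B. D b \<noteq> {}}"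
  define z where "z = (\<lambda>b (i::unit) (j::unit). \<Sum>i\<in>D b. u b i i)"
  define Z where "Z = {M \<in> C. \<forall>N\<in>C. mmul X M N = mmul X N M}"
  have zlc: "z b s t = lc (\<lambda>b' i j. if b' = b \<and> i = j then 1 else 0)" if "b \<in> B" for b s t
  proof -
    have "(\<Sum>j\<in>D b'. mscale (if b' = b \<and> i = j then 1 else 0) (u b' i j))
        = (if b' = b then u b i i else 0)" if "b' \<in> B" "i \<in> D b'" for b' i
    proof -
      have "(\<Sum>j\<in>D b'. mscale (if b' = b \<and> i = j then 1 else 0) (u b' i j))
          = (\<Sum>j\<in>D b'. if j = i then if b' = b then u b i i else 0 else 0)"
        by (intro sum.cong) auto
      then show ?thesis using that fin_D[of b'] by (simp add: sum.delta)
    qed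
    then have "lc (\<lambda>b' i j. if b' = b \<and> i = j then 1 else 0)
        = (\<Sum>b'\<in>B. if b' = b then \<Sum>i\<in>D b. u b i i else 0)"
      unfolding lc_def by (intro sum.cong refl) auto
    then show ?thesis using that fin_B by (simp add: z_def sum.delta)
  qed
  have zC: "z b s t \<in> C" if "b \<in> B" for b s t using zlc[OF that] lc_in by simp
  have zu: "mmul X (z b s t) (u b' i j) = (if b = b' then u b i j else 0)"
    and uz: "mmul X (u b' i j) (z b s t) = (if b = b' then u b i j else 0)"
    if "b \<in> B" "b' \<in> B" "i \<in> D b'" "j \<in> D b'" for b b' i j s t
  proof -
    have "mmul X (z b s t) (u b' i j) = (\<Sum>k\<in>D b. if k = i then if b = b' then u b i j else 0 else 0)"
      unfolding z_def mmul_sum_left using that by (intro sum.cong) (auto simp: u_mult)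
    then show "mmul X (z b s t) (u b' i j) = (if b = b' then u b i j else 0)"
      using that fin_D[of b] by (auto simp: sum.delta)
    have "mmul X (u b' i j) (z b s t) = (\<Sum>k\<in>D b. if k = j then if b = b' then u b i j else 0 else 0)"
      unfolding z_def mmul_sum_right using that by (intro sum.cong) (auto simp: u_mult)
    then show "mmul X (u b' i j) (z b s t) = (if b = b' then u b i j else 0)"
      using that fin_D[of b] by (auto simp: sum.delta)
  qed
  have Zsub: "mat.subspace Z"
    by (rule mat.subspaceI)
      (auto simp: Z_def mmul_linear mat.subspace_0[OF subspace_C] mat.subspace_add[OF subspace_C]
        mat.subspace_scale[OF subspace_C])
  have zZ: "z b s t \<in> Z" if "b \<in> B" for b s t
  proof -
    have "mmul X (z b s t) (lc c) = mmul X (lc c) (z b s t)" for c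
      unfolding lc_def mmul_linear using that by (intro sum.cong refl) (simp add: zu uz)
    then show ?thesis using zC[OF that] by (auto simp: Z_def elim!: lc_surj)
  qed
  have eZ: "e \<in> Z" using e_in e_left e_right by (simp add: Z_def)
  have "M \<in> mat.span {z b s t | b s t. b \<in> B' \<and> s \<in> UNIV \<and> t \<in> UNIV}" if "M \<in> Z" for M
  proof -
    obtain c where c: "M = lc c" using \<open>M \<in> Z\<close> by (auto simp: Z_def elim: lc_surj)
    \<comment> \<open>Centrality moves \<open>M\<close> to the front of the sandwich, leaving
      \<open>M\<close> times the product of two units. Hence off-diagonal coefficients vanish and
      the diagonal ones agree within a block.\<close>
    have M: "mscale (c b i j) (u b k l) = (if i = j then mmul X M (u b k l) else 0)"
      if "b \<in> B" "i \<in> D b" "j \<in> D b" "k \<in> D b" "l \<in> D b" for b i j k l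
    proof -
      have "mscale (c b i j) (u b k l) = mmul X (mmul X M (u b k i)) (u b j l)"
        using u_lc_u[of b k i j l c] that u_in[of b k i] \<open>M \<in> Z\<close> c by (simp add: Z_def)
      then show ?thesis using that by (simp add: mmul_assoc u_mult mmul_zero_right)
    qed
    have off: "c b i j = 0" if "b \<in> B" "i \<in> D b" "j \<in> D b" "i \<noteq> j" for b i j
      using M[of b i j i j] that u_nonzero by simp
    have diag: "c b i i = c b j j" if "b \<in> B" "i \<in> D b" "j \<in> D b" for b i j
      using M[of b i i i i] M[of b j j i i] that u_nonzero[of b i i]
        mat.scale_right_imp_eq[of "u b i i" "c b i i" "c b j j"] by simp
    define d where "d b = c b (SOME i. i \<in> D b) (SOME i. i \<in> D b)" for b
    have d: "c b i j = (if i = j then d b else 0)" if "b \<in> B" "i \<in> D b" "j \<in> D b" for b i j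
      using off[of b i j] diag[of b i "SOME i. i \<in> D b"] that someI[of "\<lambda>i. i \<in> D b"] by (auto simp: d_def)
    have "M = (\<Sum>b\<in>B. \<Sum>i\<in>D b. mscale (d b) (u b i i))"
    proof -
      have "(\<Sum>j\<in>D b. mscale (c b i j) (u b i j)) = mscale (d b) (u b i i)"
        if "b \<in> B" "i \<in> D b" for b i
      proof -
        have "(\<Sum>j\<in>D b. mscale (c b i j) (u b i j)) = (\<Sum>j\<in>D b. if j = i then mscale (d b) (u b i i) else 0)"
          using that d by (intro sum.cong) auto
        then show ?thesis using that fin_D[of b] by (simp add: sum.delta)
      qed
      then show ?thesis unfolding c lc_def by (intro sum.cong refl) auto
    qed
    also have "\<dots> = (\<Sum>b\<in>B. mscale (d b) (z b () ()))"
      by (simp add: z_def mat.scale_sum_right)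
    also have "\<dots> = (\<Sum>b\<in>B'. mscale (d b) (z b () ()))"
      using fin_B by (intro sum.mono_neutral_right) (auto simp: B'_def z_def)
    also have "\<dots> \<in> mat.span {z b s t | b s t. b \<in> B' \<and> s \<in> UNIV \<and> t \<in> UNIV}"
      by (intro mat.span_sum mat.span_scale mat.span_base) auto
    finally show ?thesis .
  qed
  moreover have "mat.span {z b s t | b s t. b \<in> B' \<and> s \<in> UNIV \<and> t \<in> UNIV} \<subseteq> Z"
    by (rule mat.span_minimal) (use zZ Zsub in \<open>auto simp: B'_def\<close>)
  ultimately have Zeq: "Z = mat.span {z b s t | b s t. b \<in> B' \<and> s \<in> UNIV \<and> t \<in> UNIV}" by blast
  interpret Z: mat_units X Z e B' "\<lambda>_. UNIV" z
  proof
    fix b s t assume b: "b \<in> B'" 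
    then obtain i where i: "b \<in> B" "i \<in> D b" by (auto simp: B'_def)
    then have "mmul X (z b s t) (u b i i) \<noteq> 0" using zu u_nonzero by simp
    then show "z b s t \<noteq> 0" by (auto simp: mmul_zero_left)
    fix b' k l assume b': "b' \<in> B'"
    have "mmul X (z b s t) (\<Sum>i\<in>D b'. u b' i i) = (\<Sum>i\<in>D b'. if b = b' then u b i i else 0)"
      using b b' by (simp add: mmul_sum_right zu B'_def)
    then show "mmul X (z b s t) (z b' k l) = (if b = b' \<and> t = k then z b s l else 0)"
      by (simp add: z_def)
  qed (use fin_B Zeq eZ e_left e_right in \<open>auto simp: B'_def Z_def\<close>)
  have "center_algebra A = sub_mat X Z e"
    by (simp add: center_algebra_def Z_def sub_mat_def)
  then show ?thesis using Z.semisimple by simp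
qed

text \<open>The assumptions say that \<open>f\<close> acts on the units as the sum of the
  \<open>u b s s\<close> with \<open>b \<in> B'\<close>. The corner is then spanned by these
  orthogonal idempotents, so it is again an instance of the locale, with blocks of degree
  one.\<close>

theorem semisimple_corner:
  assumes f: "f \<in> C" and B': "B' \<subseteq> B" "\<And>b. b \<in> B' \<Longrightarrow> s \<in> D b"
    and fu: "\<And>b i j. \<lbrakk>b \<in> B; i \<in> D b; j \<in> D b\<rbrakk> \<Longrightarrow> mmul X f (u b i j) = (if b \<in> B' \<and> i = s then u b i j else 0)"
    and uf: "\<And>b i j. \<lbrakk>b \<in> B; i \<in> D b; j \<in> D b\<rbrakk> \<Longrightarrow> mmul X (u b i j) f = (if b \<in> B' \<and> j = s then u b i j else 0)"
  shows "semisimple_algebra (corner_algebra A f)"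
proof -
  define E where "E = {mmul X (mmul X f M) f | M. M \<in> C}"
  define v where "v = (\<lambda>b (i::unit) (j::unit). u b s s)"
  \<comment> \<open>The sandwich formula shows that \<open>f\<close> has nonzero coefficients only
    at \<open>(s, s)\<close> in blocks of \<open>B'\<close>, and multiplication by \<open>f\<close>
    leaves these unchanged.\<close>
  have ff: "mmul X f f = f"
  proof -
    obtain c where c: "f = lc c" using f by (rule lc_surj)
    have "mmul X f (lc c) = (\<Sum>b\<in>B. \<Sum>i\<in>D b. \<Sum>j\<in>D b. mscale (if b \<in> B' \<and> i = s then c b i j else 0) (u b i j))"
      unfolding lc_def mmul_linear by (intro sum.cong refl) (simp add: fu)
    also have "\<dots> = lc (\<lambda>b i j. if b \<in> B' \<and> i = s then c b i j else 0)" by (simp add: lc_def)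
    also have "\<dots> = lc c"
    proof (rule lc_cong)
      fix b i j assume b: "b \<in> B" "i \<in> D b" "j \<in> D b"
      have "mscale (c b i j) (u b i j) = mmul X (mmul X (u b i i) f) (u b j j)"
        using u_lc_u[of b i i j j c] b c by simp
      also have "\<dots> = (if b \<in> B' \<and> i = s \<and> i = j then u b i j else 0)"
        using b by (auto simp: uf u_mult mmul_zero_left)
      finally show "(if b \<in> B' \<and> i = s then c b i j else 0) = c b i j"
        using u_nonzero[OF b] by (auto split: if_splits)
    qed
    finally show ?thesis using c by simp
  qed
  have E_in: "mmul X f M = M" "mmul X M f = M" "M \<in> C" if "M \<in> E" for M
    using that f mult_in ff by (auto simp: E_def mmul_assoc) (metis mmul_assoc ff)+
  have fE: "f \<in> E" using f ff by (auto simp: E_def intro!: exI[of _ f])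
  have EI: "M \<in> E" if "M \<in> C" "mmul X f M = M" "mmul X M f = M" for M
    using that by (auto simp: E_def intro!: exI[of _ M])
  have Esub: "mat.subspace E"
    by (rule mat.subspaceI)
      (auto intro!: EI simp: E_in mmul_linear mat.subspace_0[OF subspace_C] mat.subspace_add[OF subspace_C]
        mat.subspace_scale[OF subspace_C])
  have vE: "v b i j \<in> E" if "b \<in> B'" for b i j
    unfolding v_def using that B' by (intro EI u_in) (auto simp: fu uf subset_iff)
  have "M \<in> mat.span {v b s t | b s t. b \<in> B' \<and> s \<in> UNIV \<and> t \<in> UNIV}" if "M \<in> E" for M
  proof -
    obtain c where c: "M = lc c" using E_in(3)[OF \<open>M \<in> E\<close>] by (rule lc_surj)
    have "M = mmul X (mmul X f M) f" using E_in[OF that] by simp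
    also have "\<dots> = (\<Sum>b\<in>B. \<Sum>i\<in>D b. \<Sum>j\<in>D b. mscale (c b i j) (if b \<in> B' \<and> i = s \<and> j = s then v b () () else 0))"
      unfolding c lc_def mmul_linear by (intro sum.cong refl) (auto simp: fu uf v_def mmul_zero_left)
    also have "\<dots> \<in> mat.span {v b s t | b s t. b \<in> B' \<and> s \<in> UNIV \<and> t \<in> UNIV}"
      by (intro mat.span_sum mat.span_scale) (auto intro!: mat.span_base mat.span_zero)
    finally show ?thesis .
  qed
  moreover have "mat.span {v b s t | b s t. b \<in> B' \<and> s \<in> UNIV \<and> t \<in> UNIV} \<subseteq> E"
    by (rule mat.span_minimal) (use vE Esub in auto)
  ultimately have Eeq: "E = mat.span {v b s t | b s t. b \<in> B' \<and> s \<in> UNIV \<and> t \<in> UNIV}" by blast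
  interpret E: mat_units X E f B' "\<lambda>_. UNIV" v
    by unfold_locales
      (use fin_B B' Eeq fE E_in u_nonzero in \<open>auto simp: v_def u_mult subset_iff intro: finite_subset\<close>)
  have "corner_algebra A f = sub_mat X E f"
    by (simp add: corner_algebra_def E_def sub_mat_def)
  then show ?thesis using E.semisimple by simp
qed

end

text \<open>The natural labels of the units are subsets of coordinates and tuples; the theorem
  indexes the summands by equivalence classes and their rows by numbers.\<close>

lemma (in mat_units) reindex:
  assumes \<phi>: "bij_betw \<phi> B' B" and \<eta>: "\<And>b. b \<in> B' \<Longrightarrow> bij_betw (\<eta> b) (D' b) (D (\<phi> b))"
  shows "mat_units X C e B' D' (\<lambda>b i j. u (\<phi> b) (\<eta> b i) (\<eta> b j))"
proof
  have \<phi>B: "\<phi> b \<in> B" if "b \<in> B'" for b using \<phi> that by (auto simp: bij_betw_def)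
  have \<eta>D: "\<eta> b i \<in> D (\<phi> b)" if "b \<in> B'" "i \<in> D' b" for b i using \<eta>[of b] that by (auto simp: bij_betw_def)
  show "finite B'" using \<phi> fin_B by (simp add: bij_betw_finite)
  show "finite (D' b)" if "b \<in> B'" for b
    using bij_betw_finite[OF \<eta>[OF that]] fin_D[OF \<phi>B[OF that]] by simp
  have "{u (\<phi> b) (\<eta> b i) (\<eta> b j) | b i j. b \<in> B' \<and> i \<in> D' b \<and> j \<in> D' b}
      = {u b i j | b i j. b \<in> B \<and> i \<in> D b \<and> j \<in> D b}" (is "?L = ?R")
  proof
    show "?L \<subseteq> ?R" using \<phi>B \<eta>D by blast
    show "?R \<subseteq> ?L"
    proof
      fix M assume "M \<in> ?R"
      then obtain b i j where M: "M = u b i j" "b \<in> B" "i \<in> D b" "j \<in> D b" by auto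
      then obtain b' where b': "b' \<in> B'" "b = \<phi> b'" using \<phi> by (auto simp: bij_betw_def)
      moreover from b' M have "i \<in> \<eta> b' ` D' b'" "j \<in> \<eta> b' ` D' b'"
        using \<eta>[of b'] by (simp_all add: bij_betw_def)
      then obtain i' j' where "i' \<in> D' b'" "i = \<eta> b' i'" "j' \<in> D' b'" "j = \<eta> b' j'" by blast
      ultimately show "M \<in> ?L" using M by auto
    qed
  qed
  then show "C = mat.span {u (\<phi> b) (\<eta> b i) (\<eta> b j) | b i j. b \<in> B' \<and> i \<in> D' b \<and> j \<in> D' b}"
    using C_eq by simp
  show "mmul X (u (\<phi> b) (\<eta> b i) (\<eta> b j)) (u (\<phi> b') (\<eta> b' k) (\<eta> b' l))
      = (if b = b' \<and> j = k then u (\<phi> b) (\<eta> b i) (\<eta> b l) else 0)"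
    if "b \<in> B'" "i \<in> D' b" "j \<in> D' b" "b' \<in> B'" "k \<in> D' b'" "l \<in> D' b'" for b i j b' k l
  proof -
    have "\<phi> b = \<phi> b' \<longleftrightarrow> b = b'" using \<phi> that by (auto simp: bij_betw_def inj_on_def)
    moreover have "\<eta> b j = \<eta> b k \<longleftrightarrow> j = k" if "b = b'"
      using \<eta>[of b] that \<open>b \<in> B'\<close> \<open>j \<in> D' b\<close> \<open>k \<in> D' b'\<close> by (auto simp: bij_betw_def inj_on_def)
    ultimately show ?thesis using that by (auto simp: u_mult \<phi>B \<eta>D)
  qed
  show "u (\<phi> b) (\<eta> b i) (\<eta> b j) \<noteq> 0" if "b \<in> B'" "i \<in> D' b" "j \<in> D' b" for b i j
    using that by (intro u_nonzero \<phi>B \<eta>D)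
qed (fact e_in e_left e_right)+

section \<open>The local algebras\<close>

type_synonym 'f coef = "'f \<times> 'f \<times> 'f \<times> 'f \<times> 'f"

text \<open>
  A coefficient vector \<open>(p, q, r, s, t)\<close> stands for the matrix on \<open>U\<close> with blocks
  \<open>p\<close>, \<open>q J\<close>, \<open>r J\<close>, \<open>s J + t I\<close> with respect to the partition of \<open>U\<close> into
  the base point and the remaining points. The vector is not unique if \<open>U\<close> has two elements.
\<close>

fun local_mat :: "'u \<Rightarrow> 'f::field coef \<Rightarrow> 'u \<Rightarrow> 'u \<Rightarrow> 'f" where
  "local_mat x (p, q, r, s, t) y z =
     (if y = x then if z = x then p else q
      else if z = x then r else s + (if y = z then t else 0))"

text \<open>Block multiplication of the matrices described above: a factor \<open>m\<close> appears
  wherever an all-one row or block meets an all-one column or block over the remaining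
  points.\<close>

fun lmul :: "'f::field \<Rightarrow> 'f coef \<Rightarrow> 'f coef \<Rightarrow> 'f coef" where
  "lmul m (p, q, r, s, t) (p', q', r', s', t') =
     (p * p' + m * q * r', p * q' + m * q * s' + q * t', r * p' + m * s * r' + t * r',
      r * q' + m * s * s' + s * t' + t * s', t * t')"

lemma local_mat_mult:
  fixes v w :: "'f::field coef"
  assumes "finite V" "x \<in> V" "y \<in> V" "z \<in> V"
  shows "(\<Sum>a\<in>V. local_mat x v y a * local_mat x w a z)
    = local_mat x (lmul (of_nat (card V - 1)) v w) y z"
proof -
  obtain p q r s t p' q' r' s' t' where v: "v = (p, q, r, s, t)" and w: "w = (p', q', r', s', t')"
    by (metis prod_cases5)
  have V: "(\<Sum>a\<in>V. f a) = f x + (\<Sum>a\<in>V - {x}. f a)" for f :: "'a \<Rightarrow> 'f"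
    using assms(1,2) by (rule sum.remove)
  have card: "of_nat (card (V - {x})) = (of_nat (card V - 1) :: 'f)"
    using assms by simp
  have d1: "(\<Sum>a\<in>V - {x}. if a = b then c else 0) = (if b = x then 0 else c)"
    if "b \<in> V" for b and c :: 'f
    using that assms(1) by auto
  have "(\<Sum>a\<in>V - {x}. local_mat x v y a * local_mat x w a z)
    = (if y = x then if z = x then of_nat (card (V - {x})) * (q * r')
        else of_nat (card (V - {x})) * (q * s') + q * t'
      else if z = x then of_nat (card (V - {x})) * (s * r') + t * r'
      else of_nat (card (V - {x})) * (s * s') + s * t' + t * s' + (if y = z then t * t' else 0))"
  proof (cases "y = x"; cases "z = x")
    assume *: "y = x" "z = x"
    then have "(\<Sum>a\<in>V - {x}. local_mat x v y a * local_mat x w a z) = (\<Sum>a\<in>V - {x}. q * r')"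
      by (intro sum.cong) (auto simp: v w)
    with * show ?thesis by simp
  next
    assume *: "y = x" "z \<noteq> x"
    then have "(\<Sum>a\<in>V - {x}. local_mat x v y a * local_mat x w a z)
        = (\<Sum>a\<in>V - {x}. q * s' + (if a = z then q * t' else 0))"
      by (intro sum.cong) (auto simp: v w algebra_simps)
    with * assms show ?thesis by (simp add: sum.distrib d1 del: sum.delta sum.delta')
  next
    assume *: "y \<noteq> x" "z = x"
    then have "(\<Sum>a\<in>V - {x}. local_mat x v y a * local_mat x w a z)
        = (\<Sum>a\<in>V - {x}. s * r' + (if a = y then t * r' else 0))"
      by (intro sum.cong) (auto simp: v w algebra_simps)
    with * assms show ?thesis by (simp add: sum.distrib d1 del: sum.delta sum.delta')
  next
    assume *: "y \<noteq> x" "z \<noteq> x"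
    then have "(\<Sum>a\<in>V - {x}. local_mat x v y a * local_mat x w a z)
        = (\<Sum>a\<in>V - {x}. s * s' + (if a = z then s * t' else 0) + (if a = y then t * s' else 0)
            + (if a = y then if y = z then t * t' else 0 else 0))"
      by (intro sum.cong) (auto simp: v w algebra_simps)
    with * assms show ?thesis by (simp add: sum.distrib d1 del: sum.delta sum.delta')
  qed
  then show ?thesis
    unfolding V card by (simp add: v w algebra_simps)
qed

lemma local_mat_zero [simp]: "local_mat x (0, 0, 0, 0, 0) y z = 0"
  by simp

section \<open>Tensor products of local matrices\<close>

lemma prod_indicator:
  "finite I \<Longrightarrow> (\<Prod>i\<in>I. if P i then 1 else 0) = (if \<forall>i\<in>I. P i then 1 else (0::'f::field))"
  by (induction I rule: finite_induct) auto

abbreviation one_coef :: "'f::field coef" where "one_coef \<equiv> (1, 0, 0, 0, 1)"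

text \<open>The local factor of \<open>dual_idem\<close>. Every value other than 1 counts as 0, in
  agreement with the test \<open>g a = 1\<close> in \<open>fact_rel\<close>.\<close>

fun shell_coef :: "nat \<Rightarrow> 'f::field coef" where
  "shell_coef a = (if a = 1 then (0, 0, 0, 0, 1) else (1, 0, 0, 0, 0))"

text \<open>The local factor of \<open>adj_mat\<close>: for \<open>a = 1\<close> it is the all-one
  matrix minus the identity, in blocks.\<close>

fun adj_coef :: "nat \<Rightarrow> 'f::field coef" where
  "adj_coef a = (if a = 1 then (0, 1, 1, 1, - 1) else one_coef)"

text \<open>
  The orbitals of the symmetric group on the points other than the base point:
  \<open>KE\<close> and \<open>K11\<close> are the diagonal and the off-diagonal pairs of such points.
\<close>

datatype kind = K00 | K01 | K10 | K11 | KE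

lemma UNIV_kind: "(UNIV :: kind set) = {K00, K01, K10, K11, KE}"
  using kind.exhaust by auto

fun kind_coef :: "kind \<Rightarrow> 'f::field coef" where
  "kind_coef K00 = (1, 0, 0, 0, 0)"
| "kind_coef K01 = (0, 1, 0, 0, 0)"
| "kind_coef K10 = (0, 0, 1, 0, 0)"
| "kind_coef K11 = (0, 0, 0, 1, - 1)"
| "kind_coef KE = (0, 0, 0, 0, 1)"

text \<open>The constant value of the matrix on each orbital; on \<open>KE\<close> the all-one part
  and the identity part both contribute.\<close>

fun kind_val :: "'f::field coef \<Rightarrow> kind \<Rightarrow> 'f" where
  "kind_val (p, q, r, s, t) K00 = p"
| "kind_val (p, q, r, s, t) K01 = q"
| "kind_val (p, q, r, s, t) K10 = r"
| "kind_val (p, q, r, s, t) K11 = s"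
| "kind_val (p, q, r, s, t) KE = s + t"

lemma local_mat_kind:
  "local_mat x v y z = (\<Sum>k\<in>UNIV. kind_val v k * local_mat x (kind_coef k) y z)"
  by (cases v) (simp add: UNIV_kind)

locale factorial_scheme =
  fixes n :: nat and U :: "nat \<Rightarrow> 'u set" and x :: "nat \<Rightarrow> 'u"
  assumes fin_U: "h \<in> {1..n} \<Longrightarrow> finite (U h)" and card_U: "h \<in> {1..n} \<Longrightarrow> 2 \<le> card (U h)"
    and x_in: "x \<in> points n U"
begin

abbreviation X where "X \<equiv> points n U"

definition val :: "nat \<Rightarrow> 'f::field" where "val h = of_nat (card (U h) - 1)"

definition tens :: "(nat \<Rightarrow> 'f::field coef) \<Rightarrow> (nat \<Rightarrow> 'u) \<Rightarrow> (nat \<Rightarrow> 'u) \<Rightarrow> 'f" where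
  "tens v y z = (if y \<in> X \<and> z \<in> X then \<Prod>h\<in>{1..n}. local_mat (x h) (v h) (y h) (z h) else 0)"

lemma X_D: "\<lbrakk>y \<in> X; h \<in> {1..n}\<rbrakk> \<Longrightarrow> y h \<in> U h"
  by (auto simp: points_def)

lemma finite_X: "finite X"
  unfolding points_def by (intro finite_PiE) (auto intro: fin_U)

text \<open>The mixed-product rule for Kronecker products: the sum over all intermediate points of
  \<open>X\<close> factors into one sum for each coordinate.\<close>

lemma tens_mult: "mmul X (tens v) (tens w) = tens (\<lambda>h. lmul (val h) (v h) (w h))"
proof (intro ext)
  fix y z
  show "mmul X (tens v) (tens w) y z = tens (\<lambda>h. lmul (val h) (v h) (w h)) y z"
  proof (cases "y \<in> X \<and> z \<in> X")
    case True
    then have "mmul X (tens v) (tens w) y z = (\<Sum>a\<in>PiE {1..n} U. \<Prod>h\<in>{1..n}.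
        local_mat (x h) (v h) (y h) (a h) * local_mat (x h) (w h) (a h) (z h))"
      by (simp add: mmul_def tens_def prod.distrib points_def cong: sum.cong)
    also have "\<dots> = (\<Prod>h\<in>{1..n}. \<Sum>a\<in>U h. local_mat (x h) (v h) (y h) a * local_mat (x h) (w h) a (z h))"
      by (rule prod_sum_PiE[symmetric]) (auto intro: fin_U)
    also have "\<dots> = (\<Prod>h\<in>{1..n}. local_mat (x h) (lmul (val h) (v h) (w h)) (y h) (z h))"
      using True x_in by (intro prod.cong) (auto simp: val_def fin_U X_D local_mat_mult)
    finally show ?thesis using True by (simp add: tens_def)
  qed (auto simp: mmul_def tens_def)
qed

text \<open>The factors are compared as matrices on \<open>U h\<close>, not as coefficient vectors,
  because for two-element sets different vectors give the same matrix.\<close>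

lemma tens_cong:
  assumes "\<And>h y z. \<lbrakk>h \<in> {1..n}; y \<in> U h; z \<in> U h\<rbrakk> \<Longrightarrow> local_mat (x h) (v h) y z = local_mat (x h) (w h) y z"
  shows "tens v = tens w"
  using assms by (intro ext) (auto simp: tens_def X_D intro!: prod.cong)

lemma tens_eq_zero:
  assumes "h \<in> {1..n}" "v h = (0, 0, 0, 0, 0)"
  shows "tens v = 0"
  using assms by (intro ext) (auto simp: tens_def simp del: local_mat.simps intro!: bexI[of _ h])

text \<open>Multilinearity in all coordinates at once. The local expansion is required only at
  entries from \<open>U h\<close> and may use a family depending on \<open>h\<close>, which lets
  two-element sets work with one basis matrix fewer.\<close>

lemma tens_expand:
  assumes "\<And>h. h \<in> {1..n} \<Longrightarrow> finite (I h)"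
    and "\<And>h y z. \<lbrakk>h \<in> {1..n}; y \<in> U h; z \<in> U h\<rbrakk> \<Longrightarrow>
      local_mat (x h) (v h) y z = (\<Sum>i\<in>I h. c h i * local_mat (x h) (f h i) y z)"
  shows "tens v = (\<Sum>j\<in>PiE {1..n} I. mscale (\<Prod>h\<in>{1..n}. c h (j h)) (tens (\<lambda>h. f h (j h))))"
proof (intro ext)
  fix y z
  show "tens v y z = (\<Sum>j\<in>PiE {1..n} I. mscale (\<Prod>h\<in>{1..n}. c h (j h)) (tens (\<lambda>h. f h (j h)))) y z"
  proof (cases "y \<in> X \<and> z \<in> X")
    case True
    then have "tens v y z = (\<Prod>h\<in>{1..n}. \<Sum>i\<in>I h. c h i * local_mat (x h) (f h i) (y h) (z h))"
      unfolding tens_def by (auto intro!: prod.cong assms(2) X_D)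
    also have "\<dots> = (\<Sum>j\<in>PiE {1..n} I. \<Prod>h\<in>{1..n}. c h (j h) * local_mat (x h) (f h (j h)) (y h) (z h))"
      by (rule prod_sum_PiE) (auto intro: assms(1))
    finally show ?thesis
      using True by (simp add: sum_fun_apply2 mscale_apply tens_def prod.distrib)
  qed (auto simp: sum_fun_apply2 mscale_apply tens_def)
qed

lemma tens_one: "tens (\<lambda>_. one_coef) = (\<lambda>y z. if y \<in> X \<and> y = z then 1 else (0::'f::field))"
proof (intro ext)
  fix y z
  have "tens (\<lambda>_. one_coef) y z = (if y \<in> X \<and> z \<in> X then \<Prod>h\<in>{1..n}. if y h = z h then 1 else 0 else 0)"
    by (auto simp: tens_def intro!: prod.cong)
  also have "\<dots> = (if y \<in> X \<and> y = z then 1 else (0::'f))"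
    by (auto simp: prod_indicator points_def intro: PiE_ext)
  finally show "tens (\<lambda>_. one_coef) y z = (if y \<in> X \<and> y = z then 1 else (0::'f))" .
qed

lemma adj_mat_eq_tens: "adj_mat n U g = tens (\<lambda>h. adj_coef (g h) :: 'f::field coef)"
proof (intro ext)
  fix y z
  have "tens (\<lambda>h. adj_coef (g h)) y z =
      (if y \<in> X \<and> z \<in> X then \<Prod>h\<in>{1..n}. if y h \<noteq> z h \<longleftrightarrow> g h = 1 then 1 else 0 else (0::'f))"
    by (auto simp: tens_def intro!: prod.cong)
  then show "adj_mat n U g y z = (tens (\<lambda>h. adj_coef (g h)) y z :: 'f)"
    by (auto simp: prod_indicator adj_mat_def fact_rel_def)
qed

lemma dual_idem_eq_tens: "dual_idem n U x g = tens (\<lambda>h. shell_coef (g h) :: 'f::field coef)"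
proof (intro ext)
  fix y z
  have "tens (\<lambda>h. shell_coef (g h)) y z =
      (if y \<in> X \<and> z \<in> X then \<Prod>h\<in>{1..n}. if y h = z h \<and> (x h \<noteq> y h \<longleftrightarrow> g h = 1) then 1 else 0 else (0::'f))"
    by (auto simp: tens_def intro!: prod.cong)
  moreover have "y = z" if "y \<in> X" "z \<in> X" "\<forall>h\<in>{1..n}. y h = z h"
    using that by (auto simp: points_def intro: PiE_ext)
  ultimately show "dual_idem n U x g y z = (tens (\<lambda>h. shell_coef (g h)) y z :: 'f)"
    using x_in by (auto simp: prod_indicator dual_idem_def fact_rel_def)
qed

section \<open>The Terwilliger algebra as the span of the tensors\<close>

definition TC :: "((nat \<Rightarrow> 'u) \<Rightarrow> (nat \<Rightarrow> 'u) \<Rightarrow> 'f::field) set" where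
  "TC = mat.span (range tens)"

lemma tens_in: "tens v \<in> TC"
  unfolding TC_def by (rule mat.span_base) simp

lemma subspace_TC: "mat.subspace TC"
  by (simp add: TC_def)

lemma TC_induct:
  assumes "M \<in> TC" "mat.subspace S" "\<And>v. tens v \<in> S"
  shows "M \<in> S"
  using assms mat.span_minimal[of "range tens" S] by (auto simp: TC_def)

lemma TC_mult:
  assumes "M \<in> TC" "N \<in> TC"
  shows "mmul X M N \<in> TC"
proof -
  have "N \<in> {N. mmul X (tens v) N \<in> TC}" for v
    using assms(2)
    by (rule TC_induct) (auto intro!: mat.subspaceI mat.subspace_add[OF subspace_TC]
      mat.subspace_scale[OF subspace_TC] mat.subspace_0[OF subspace_TC] simp: mmul_linear tens_mult tens_in)
  then have "M \<in> {M. mmul X M N \<in> TC}"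
    by (intro TC_induct[OF assms(1)]) (auto intro!: mat.subspaceI mat.subspace_add[OF subspace_TC]
      mat.subspace_scale[OF subspace_TC] mat.subspace_0[OF subspace_TC] simp: mmul_linear)
  then show ?thesis by simp
qed

lemma TC_supp: "TC \<subseteq> {M. \<forall>y z. (y, z) \<notin> X \<times> X \<longrightarrow> M y z = 0}"
proof
  fix M :: "(nat \<Rightarrow> 'u) \<Rightarrow> (nat \<Rightarrow> 'u) \<Rightarrow> 'f::field" assume "M \<in> TC"
  then show "M \<in> {M. \<forall>y z. (y, z) \<notin> X \<times> X \<longrightarrow> M y z = 0}"
    by (rule TC_induct) (auto intro!: mat.subspaceI simp: tens_def mscale_apply)
qed

lemma one_mult:
  assumes "\<forall>y z. (y, z) \<notin> X \<times> X \<longrightarrow> M y z = 0"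
  shows "mmul X (tens (\<lambda>_. one_coef)) M = M" "mmul X M (tens (\<lambda>_. one_coef)) = M"
proof -
  have "(\<Sum>w\<in>X. (if y \<in> X \<and> y = w then 1 else 0) * M w z) = M y z" for y z
  proof -
    have "(\<Sum>w\<in>X. (if y \<in> X \<and> y = w then 1 else 0) * M w z) = (\<Sum>w\<in>X. if w = y then M y z else 0)"
      by (intro sum.cong) auto
    then show ?thesis using assms finite_X by (simp add: sum.delta)
  qed
  then show "mmul X (tens (\<lambda>_. one_coef)) M = M" by (simp add: mmul_def tens_one)
  have "(\<Sum>w\<in>X. M y w * (if w \<in> X \<and> w = z then 1 else 0)) = M y z" for y z
  proof -
    have "(\<Sum>w\<in>X. M y w * (if w \<in> X \<and> w = z then 1 else 0)) = (\<Sum>w\<in>X. if w = z then M y z else 0)"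
      by (intro sum.cong) auto
    then show ?thesis using assms finite_X by (simp add: sum.delta)
  qed
  then show "mmul X M (tens (\<lambda>_. one_coef)) = M" by (simp add: mmul_def tens_one)
qed

lemma TC_one:
  assumes "M \<in> TC"
  shows "mmul X (tens (\<lambda>_. one_coef)) M = M" "mmul X M (tens (\<lambda>_. one_coef)) = M"
  using assms TC_supp by (auto intro!: one_mult)

lemma assoc_algebra_mat_algebra: "assoc_algebra (mat_algebra X :: ('f::field, _) module)"
  unfolding mat_algebra_eq_sub_mat tens_one[symmetric]
proof (rule assoc_algebra_sub_mat)
  show "tens (\<lambda>_. one_coef) \<in> {M. \<forall>y z. (y, z) \<notin> X \<times> X \<longrightarrow> M y z = 0}"
    using TC_supp tens_in by blast
  fix M N :: "(nat \<Rightarrow> 'u) \<Rightarrow> (nat \<Rightarrow> 'u) \<Rightarrow> 'f"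
  assume "M \<in> {M. \<forall>y z. (y, z) \<notin> X \<times> X \<longrightarrow> M y z = 0}" "N \<in> {M. \<forall>y z. (y, z) \<notin> X \<times> X \<longrightarrow> M y z = 0}"
  then show "mmul X M N \<in> {M. \<forall>y z. (y, z) \<notin> X \<times> X \<longrightarrow> M y z = 0}"
    by (auto simp: mmul_def)
qed (auto intro!: mat.subspaceI one_mult simp: mscale_apply)

text \<open>The kind of a pair is determined by whether its row is the base point, whether its
  column is, and whether the two agree. The two shells and the relation prescribe exactly these
  three answers in every coordinate.\<close>

lemma tens_kind_eq:
  "tens (\<lambda>h. kind_coef (j h)) =
     mmul X (mmul X (dual_idem n U x (\<lambda>h\<in>{1..n}. if j h \<in> {K00, K01} then 0 else 1))
       (adj_mat n U (\<lambda>h\<in>{1..n}. if j h \<in> {K00, KE} then 0 else 1)))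
       (dual_idem n U x (\<lambda>h\<in>{1..n}. if j h \<in> {K00, K10} then 0 else 1))"
  unfolding adj_mat_eq_tens dual_idem_eq_tens tens_mult
proof (rule tens_cong)
  fix h y z assume "h \<in> {1..n}"
  then show "local_mat (x h) (kind_coef (j h)) y z =
    local_mat (x h) (lmul (val h) (lmul (val h)
      (shell_coef ((\<lambda>h\<in>{1..n}. if j h \<in> {K00, K01} then 0 else 1) h))
      (adj_coef ((\<lambda>h\<in>{1..n}. if j h \<in> {K00, KE} then 0 else 1) h)))
      (shell_coef ((\<lambda>h\<in>{1..n}. if j h \<in> {K00, K10} then 0 else 1) h))) y z"
    by (cases "j h") simp_all
qed

text \<open>Tensors of orbital matrices are products of generators by \<open>tens_kind_eq\<close>,
  and every tensor expands into them.\<close>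

lemma TC_subset_subalgebra:
  assumes B: "is_subalgebra B (mat_algebra X)"
    and G: "adj_mat n U ` tuples n \<union> dual_idem n U x ` tuples n \<subseteq> B"
  shows "TC \<subseteq> B"
proof -
  interpret B: subring B "mat_algebra X" using B by (simp add: is_subalgebra_def)
  have mult: "mmul X M N \<in> B" if "M \<in> B" "N \<in> B" for M N
    using that submonoid.m_closed[OF B.submonoid_axioms] by (simp add: mat_algebra_eq_sub_mat)
  have subsp: "mat.subspace B"
  proof (rule mat.subspaceI)
    show "0 \<in> B" using subgroup.one_closed[OF B.subgroup_axioms] by (simp add: mat_algebra_eq_sub_mat)
    show "M + N \<in> B" if "M \<in> B" "N \<in> B" for M N
      using that subgroup.m_closed[OF B.subgroup_axioms] by (simp add: mat_algebra_eq_sub_mat)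
    show "mscale c M \<in> B" if "M \<in> B" for c M
      using that B by (simp add: is_subalgebra_def mat_algebra_eq_sub_mat)
  qed
  have "tens (\<lambda>h. kind_coef (j h)) \<in> B" for j
  proof -
    have "(\<lambda>h\<in>{1..n}. if j h \<in> S then 0 else 1) \<in> tuples n" for S
      by (auto simp: tuples_def)
    then show ?thesis unfolding tens_kind_eq using G by (intro mult) blast+
  qed
  then have "tens v \<in> B" for v
    by (subst tens_expand[where I = "\<lambda>_. UNIV", OF _ local_mat_kind])
      (auto simp: UNIV_kind intro!: mat.subspace_sum mat.subspace_scale subsp)
  then show ?thesis unfolding TC_def using subsp by (intro mat.span_minimal) auto
qed

lemma is_subalgebra_TC: "is_subalgebra TC (mat_algebra X :: ('f::field, _) module)"
proof -
  interpret M: assoc_algebra "mat_algebra X :: ('f, _) module" by (rule assoc_algebra_mat_algebra)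
  have "subring TC (mat_algebra X :: ('f, _) module)"
  proof (rule M.subringI)
    fix N :: "(nat \<Rightarrow> 'u) \<Rightarrow> (nat \<Rightarrow> 'u) \<Rightarrow> 'f" assume N: "N \<in> TC"
    then have "- N \<in> TC" by (rule mat.subspace_neg[OF subspace_TC])
    moreover have "\<ominus>\<^bsub>mat_algebra X\<^esub> N = - N"
      by (rule M.minus_equality) (use N \<open>- N \<in> TC\<close> TC_supp in \<open>auto simp: mat_algebra_eq_sub_mat\<close>)
    ultimately show "\<ominus>\<^bsub>mat_algebra X\<^esub> N \<in> TC" by simp
  next
    show "TC \<subseteq> carrier (mat_algebra X :: ('f, _) module)"
      unfolding mat_algebra_eq_sub_mat sub_mat_simps by (rule TC_supp)
    show "\<one>\<^bsub>mat_algebra X :: ('f, _) module\<^esub> \<in> TC"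
      unfolding mat_algebra_eq_sub_mat sub_mat_simps tens_one[symmetric] by (rule tens_in)
  next
    fix M N :: "(nat \<Rightarrow> 'u) \<Rightarrow> (nat \<Rightarrow> 'u) \<Rightarrow> 'f" assume "M \<in> TC" "N \<in> TC"
    then show "M \<otimes>\<^bsub>mat_algebra X\<^esub> N \<in> TC" "M \<oplus>\<^bsub>mat_algebra X\<^esub> N \<in> TC"
      unfolding mat_algebra_eq_sub_mat sub_mat_simps
      by (rule TC_mult, rule mat.subspace_add[OF subspace_TC])
  qed
  moreover have "c \<odot>\<^bsub>mat_algebra X\<^esub> M \<in> TC" if "M \<in> TC" for c and M :: "(nat \<Rightarrow> 'u) \<Rightarrow> (nat \<Rightarrow> 'u) \<Rightarrow> 'f"
    unfolding mat_algebra_eq_sub_mat sub_mat_simps using that by (rule mat.subspace_scale[OF subspace_TC])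
  ultimately show ?thesis
    unfolding is_subalgebra_def by blast
qed

theorem terwilliger_eq:
  "terwilliger_algebra TYPE('f::field) n U x = sub_mat X TC (tens (\<lambda>_. one_coef))"
proof -
  let ?G = "adj_mat n U ` tuples n \<union> dual_idem n U x ` tuples n
    :: ((nat \<Rightarrow> 'u) \<Rightarrow> (nat \<Rightarrow> 'u) \<Rightarrow> 'f) set"
  have "?G \<subseteq> TC" by (auto simp: adj_mat_eq_tens dual_idem_eq_tens tens_in)
  then have "TC \<in> {B. is_subalgebra B (mat_algebra X) \<and> ?G \<subseteq> B}"
    using is_subalgebra_TC by simp
  moreover have "TC \<subseteq> B" if "B \<in> {B. is_subalgebra B (mat_algebra X) \<and> ?G \<subseteq> B}" for B
    by (rule TC_subset_subalgebra) (use that in simp_all)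
  ultimately have "\<Inter>{B. is_subalgebra B (mat_algebra X) \<and> ?G \<subseteq> B} = TC"
    by (intro equalityI Inter_lower Inter_greatest)
  then show ?thesis
    unfolding terwilliger_algebra_def generated_subalgebra_def
    by (simp add: mat_algebra_eq_sub_mat sub_mat_def tens_one)
qed

end

section \<open>Matrix units of the Terwilliger algebra\<close>

text \<open>
  If \<open>m = |U| - 1\<close> is invertible, the local algebra is a full matrix algebra of degree 2,
  with units \<open>unit_coef m False a c\<close>, plus, if \<open>|U| > 2\<close>, a copy of the field,
  with identity \<open>unit_coef m True 1 1\<close>.
\<close>

definition unit_coef :: "'f::field \<Rightarrow> bool \<Rightarrow> nat \<Rightarrow> nat \<Rightarrow> 'f coef" where
  "unit_coef m w a c =
     (if w then (0, 0, 0, - 1 / m, 1)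
      else if a = 0 then if c = 0 then (1, 0, 0, 0, 0) else (0, 1 / m, 0, 0, 0)
      else if c = 0 then (0, 0, 1, 0, 0) else (0, 0, 0, 1 / m, 0))"

text \<open>Products through the remaining points produce a factor \<open>m\<close>, cancelled by
  the \<open>1 / m\<close> in the units; I - J / m is orthogonal to all-one rows and columns.
  Indices matter only as zero or nonzero, and not at all in the one-dimensional component.\<close>

lemma unit_coef_mult:
  assumes "m \<noteq> 0"
  shows "lmul m (unit_coef m w a c) (unit_coef m w' b d)
    = (if w = w' \<and> (w \<or> (c = 0 \<longleftrightarrow> b = 0)) then unit_coef m w a d else (0, 0, 0, 0, 0))"
  using assms by (auto simp: unit_coef_def divide_simps)

context factorial_scheme
begin

text \<open>These points supply test entries: a pair of points off the base, distinct wherever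
  \<open>U h\<close> has room for that.\<close>

lemma ex_points:
  obtains y1 y2 where "\<And>h. h \<in> {1..n} \<Longrightarrow> y1 h \<in> U h \<and> y1 h \<noteq> x h \<and> y2 h \<in> U h \<and> y2 h \<noteq> x h \<and>
    (card (U h) > 2 \<longrightarrow> y1 h \<noteq> y2 h)"
proof -
  have "\<exists>p. fst p \<in> U h \<and> fst p \<noteq> x h \<and> snd p \<in> U h \<and> snd p \<noteq> x h \<and> (card (U h) > 2 \<longrightarrow> fst p \<noteq> snd p)"
    if h: "h \<in> {1..n}" for h
  proof -
    have c: "card (U h - {x h}) = card (U h) - 1"
      using fin_U[OF h] X_D[OF x_in h] by simp
    then have "card (U h - {x h}) \<noteq> 0" using card_U[OF h] by simp
    then obtain a where a: "a \<in> U h - {x h}" by (metis card.empty ex_in_conv)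
    show ?thesis
    proof (cases "card (U h) > 2")
      case True
      then have "card (U h - {x h} - {a}) \<noteq> 0"
        using c a fin_U[OF h] by simp
      then obtain b where "b \<in> U h - {x h} - {a}" by (metis card.empty ex_in_conv)
      with a show ?thesis by (intro exI[of _ "(a, b)"]) auto
    next
      case False with a show ?thesis by (intro exI[of _ "(a, a)"]) auto
    qed
  qed
  then obtain p where "\<forall>h\<in>{1..n}. fst (p h) \<in> U h \<and> fst (p h) \<noteq> x h \<and> snd (p h) \<in> U h \<and>
      snd (p h) \<noteq> x h \<and> (card (U h) > 2 \<longrightarrow> fst (p h) \<noteq> snd (p h))"
    by metis
  then show ?thesis by (intro that[of "fst \<circ> p" "snd \<circ> p"]) auto
qed

lemma two_points:
  assumes h: "h \<in> {1..n}" "\<not> card (U h) > 2" and yz: "y \<in> U h" "z \<in> U h" "y \<noteq> x h" "z \<noteq> x h"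
  shows "y = z"
proof -
  have c: "card (U h) = 2" using h(2) card_U[OF h(1)] by simp
  have "card (U h - {x h}) = 1" using c fin_U[OF h(1)] X_D[OF x_in h(1)] by simp
  then obtain a where "U h - {x h} = {a}" by (rule card_1_singletonE)
  moreover have "y \<in> U h - {x h}" "z \<in> U h - {x h}" using yz by simp_all
  ultimately show "y = z" by (metis singletonD)
qed

lemma val_two: "\<lbrakk>h \<in> {1..n}; \<not> card (U h) > 2\<rbrakk> \<Longrightarrow> val h = (1::'f::field)"
  using card_U[of h] by (simp add: val_def)

text \<open>A block is the set of coordinates in which the one-dimensional local component is taken;
  that component exists only if \<open>card (U h) > 2\<close>.\<close>

definition blocks :: "nat set set" where "blocks = Pow (circ U {1..n})"

text \<open>On \<open>W\<close> the local component has a single row, which lives off the base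
  point, so the tuple is fixed to 1 there and free elsewhere.\<close>

definition block_index :: "nat set \<Rightarrow> (nat \<Rightarrow> nat) set" where
  "block_index W = {a \<in> tuples n. W \<subseteq> supp n a}"

definition munit :: "nat set \<Rightarrow> (nat \<Rightarrow> nat) \<Rightarrow> (nat \<Rightarrow> nat) \<Rightarrow> (nat \<Rightarrow> 'u) \<Rightarrow> (nat \<Rightarrow> 'u) \<Rightarrow> 'f::field" where
  "munit W a c = tens (\<lambda>h. unit_coef (val h) (h \<in> W) (a h) (c h))"

lemma tuples_D: "\<lbrakk>a \<in> tuples n; h \<in> {1..n}\<rbrakk> \<Longrightarrow> a h = 0 \<or> a h = 1"
  by (auto simp: tuples_def PiE_iff)

lemma tuples_eqI: "\<lbrakk>a \<in> tuples n; b \<in> tuples n; \<And>h. h \<in> {1..n} \<Longrightarrow> a h = b h\<rbrakk> \<Longrightarrow> a = b"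
  unfolding tuples_def by (rule PiE_ext)

lemma munit_mult:
  assumes val: "\<forall>h\<in>{1..n}. val h \<noteq> (0::'f::field)"
    and W: "W \<in> blocks" "W' \<in> blocks"
    and a: "c \<in> block_index W" "b \<in> block_index W'"
  shows "mmul X (munit W a c) (munit W' b d :: _ \<Rightarrow> _ \<Rightarrow> 'f) = (if W = W' \<and> c = b then munit W a d else 0)"
proof -
  define w :: "nat \<Rightarrow> 'f coef" where
    "w h = lmul (val h) (unit_coef (val h) (h \<in> W) (a h) (c h)) (unit_coef (val h) (h \<in> W') (b h) (d h))" for h
  have w: "w h = (if (h \<in> W) = (h \<in> W') \<and> (h \<in> W \<or> (c h = 0 \<longleftrightarrow> b h = 0))
      then unit_coef (val h) (h \<in> W) (a h) (d h) else (0, 0, 0, 0, 0))" if "h \<in> {1..n}" for h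
    unfolding w_def using bspec[OF val that] by (rule unit_coef_mult)
  have prod: "mmul X (munit W a c) (munit W' b d) = tens w"
    by (simp add: munit_def tens_mult w_def[abs_def])
  consider "W = W'" "c = b" | h where "h \<in> {1..n}" "(h \<in> W) \<noteq> (h \<in> W')"
    | h where "W = W'" "h \<in> {1..n}" "c h \<noteq> b h"
  proof -
    have "W \<subseteq> {1..n}" "W' \<subseteq> {1..n}" using W by (auto simp: blocks_def circ_def)
    then have "W = W' \<or> (\<exists>h\<in>{1..n}. (h \<in> W) \<noteq> (h \<in> W'))" by blast
    moreover have "c = b \<or> (\<exists>h\<in>{1..n}. c h \<noteq> b h)"
      using a tuples_eqI by (auto simp: block_index_def)
    ultimately show ?thesis using that by blast
  qed
  then show ?thesis
  proof cases
    case 1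
    have "tens w = munit W a d"
      unfolding munit_def by (rule tens_cong) (use 1 in \<open>simp add: w\<close>)
    with 1 prod show ?thesis by simp
  next
    case (2 h)
    then have "tens w = 0" by (intro tens_eq_zero[of h]) (auto simp: w)
    with 2 prod show ?thesis by auto
  next
    case (3 h)
    then have "h \<notin> W" using a by (auto simp: block_index_def supp_def subset_iff)
    moreover have "(c h = 0) \<noteq> (b h = 0)"
      using 3 a tuples_D[of c h] tuples_D[of b h] by (auto simp: block_index_def)
    ultimately have "tens w = 0" using 3 by (intro tens_eq_zero[of h]) (auto simp: w)
    with 3 prod show ?thesis by auto
  qed
qed

lemma munit_nonzero:
  assumes val: "\<forall>h\<in>{1..n}. val h \<noteq> (0::'f::field)" and W: "W \<in> blocks"
  shows "munit W a c \<noteq> (0 :: _ \<Rightarrow> _ \<Rightarrow> 'f)"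
proof -
  obtain y1 y2 where y: "\<And>h. h \<in> {1..n} \<Longrightarrow> y1 h \<in> U h \<and> y1 h \<noteq> x h \<and> y2 h \<in> U h \<and> y2 h \<noteq> x h \<and>
    (card (U h) > 2 \<longrightarrow> y1 h \<noteq> y2 h)" using ex_points by metis
  \<comment> \<open>In coordinates of \<open>W\<close> the test position is off-diagonal: the entry
    of I - J / m is \<open>- 1 / m\<close> there, whereas its diagonal entry
    \<open>1 - 1 / m\<close> may vanish.\<close>
  define y where "y = (\<lambda>h\<in>{1..n}. if h \<notin> W \<and> a h = 0 then x h else y1 h)"
  define z where "z = (\<lambda>h\<in>{1..n}. if h \<notin> W \<and> c h = 0 then x h else y2 h)"
  have "y \<in> X" "z \<in> X" using y X_D[OF x_in] by (auto simp: y_def z_def points_def)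
  moreover have "local_mat (x h) (unit_coef (val h) (h \<in> W) (a h) (c h)) (y h) (z h) \<noteq> (0::'f)"
    if "h \<in> {1..n}" for h
    using y[OF that] bspec[OF val that] W that by (auto simp: y_def z_def unit_coef_def blocks_def circ_def)
  ultimately have "(munit W a c y z :: 'f) \<noteq> 0" by (simp add: munit_def tens_def)
  then show ?thesis by (metis zero_fun_apply)
qed

lemma TC_eq_span_munit:
  assumes val: "\<forall>h\<in>{1..n}. val h \<noteq> (0::'f::field)"
  shows "TC = mat.span {munit W a c :: _ \<Rightarrow> _ \<Rightarrow> 'f | W a c. W \<in> blocks \<and> a \<in> block_index W \<and> c \<in> block_index W}"
    (is "_ = mat.span ?E")
proof
  show "mat.span ?E \<subseteq> TC"
    by (rule mat.span_minimal) (auto simp: munit_def tens_in subspace_TC)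
  define I where "I h = {(False, 0::nat, 0::nat), (False, 0, 1), (False, 1, 0), (False, 1, 1)} \<union>
    (if card (U h) > 2 then {(True, 1, 1)} else {})" for h
  define f :: "nat \<Rightarrow> bool \<times> nat \<times> nat \<Rightarrow> 'f coef" where
    "f h = (\<lambda>(w, a, c). unit_coef (val h) w a c)" for h
  have "tens v \<in> mat.span ?E" for v :: "nat \<Rightarrow> 'f coef"
  proof -
    \<comment> \<open>Coefficients in the local units: since the component I - J / m enters with
      \<open>t\<close>, the unit J / m must carry \<open>m * s + t\<close> to restore
      \<open>s\<close>. For a two-element set that component is absent, but then
      \<open>m = 1\<close>, J = I and the same coefficient \<open>s + t\<close> is right.\<close>
    define co :: "nat \<Rightarrow> bool \<times> nat \<times> nat \<Rightarrow> 'f" where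
      "co h = (\<lambda>(w, a, c). case v h of (p, q, r, s, t) \<Rightarrow>
        if w then t else if a = 0 then if c = 0 then p else val h * q
        else if c = 0 then r else val h * s + t)" for h
    have "tens v = (\<Sum>j\<in>PiE {1..n} I. mscale (\<Prod>h\<in>{1..n}. co h (j h)) (tens (\<lambda>h. f h (j h))))"
    proof (rule tens_expand)
      show "finite (I h)" for h by (simp add: I_def)
      fix h y z assume h: "h \<in> {1..n}" and yz: "y \<in> U h" "z \<in> U h"
      obtain p q r s t where v: "v h = (p, q, r, s, t)" by (metis prod_cases5)
      show "local_mat (x h) (v h) y z = (\<Sum>i\<in>I h. co h i * local_mat (x h) (f h i) y z)"
      proof -
        have I: "(\<Sum>i\<in>I h. F i) = F (False, 0, 0) + F (False, 0, 1) + F (False, 1, 0) + F (False, 1, 1)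
            + (if card (U h) > 2 then F (True, 1, 1) else 0)" for F :: "_ \<Rightarrow> 'f"
          by (simp add: I_def add.assoc)
        have m: "val h \<noteq> (0::'f)" using val h by blast
        consider "y = x h \<or> z = x h" | "y \<noteq> x h" "z \<noteq> x h" "card (U h) > 2"
          | "y \<noteq> x h" "z \<noteq> x h" "\<not> card (U h) > 2" by blast
        then show ?thesis
        proof cases
          case 1 then show ?thesis using m unfolding I by (auto simp: v co_def f_def unit_coef_def)
        next
          case 2 then show ?thesis
            using m unfolding I by (simp add: v co_def f_def unit_coef_def field_simps)
        next
          case 3 then show ?thesis
            using two_points[OF h 3(3) yz 3(1,2)] unfolding I by (simp add: val_two[OF h 3(3)] v co_def f_def unit_coef_def)
        qed
      qed
    qed
    also have "\<dots> \<in> mat.span ?E"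
    proof (intro mat.span_sum mat.span_scale mat.span_base)
      fix j assume j: "j \<in> PiE {1..n} I"
      define W where "W = {h \<in> {1..n}. fst (j h)}"
      define a where "a = (\<lambda>h\<in>{1..n}. fst (snd (j h)))"
      define c where "c = (\<lambda>h\<in>{1..n}. snd (snd (j h)))"
      have jI: "j h \<in> I h" if "h \<in> {1..n}" for h using j that by auto
      have "tens (\<lambda>h. f h (j h)) = munit W a c"
        unfolding munit_def by (rule tens_cong) (auto simp: f_def W_def a_def c_def split_def)
      moreover have "W \<in> blocks" using jI by (force simp: blocks_def circ_def W_def I_def split: if_splits)
      moreover have "a \<in> tuples n" "c \<in> tuples n"
        using jI by (force simp: tuples_def a_def c_def I_def split: if_splits)+
      moreover have "W \<subseteq> supp n a" "W \<subseteq> supp n c"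
        using jI by (force simp: supp_def W_def a_def c_def I_def split: if_splits)+
      ultimately show "tens (\<lambda>h. f h (j h)) \<in> ?E" by (auto simp: block_index_def)
    qed
    finally show ?thesis .
  qed
  then show "TC \<subseteq> mat.span ?E" unfolding TC_def by (intro mat.span_minimal) auto
qed

lemma mat_units_terwilliger:
  assumes val: "\<forall>h\<in>{1..n}. val h \<noteq> (0::'f::field)"
  shows "mat_units X (TC :: (_ \<Rightarrow> _ \<Rightarrow> 'f) set) (tens (\<lambda>_. one_coef)) blocks block_index munit"
proof
  show "finite blocks" by (simp add: blocks_def circ_def)
  have "finite (tuples n)" unfolding tuples_def by (intro finite_PiE) auto
  then show "finite (block_index W)" for W by (simp add: block_index_def)
qed (fact TC_eq_span_munit[OF val] TC_one tens_in | rule munit_mult[OF val] munit_nonzero[OF val]; assumption)+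

text \<open>\<open>dual_idem\<close> at \<open>g\<close> acts as the sum of the diagonal units at
  index \<open>g\<close> over the blocks that have this index: its local factors fix or kill each
  unit, according to whether the unit starts or ends off the base point.\<close>

lemma semisimple_corner_terwilliger:
  assumes val: "\<forall>h\<in>{1..n}. val h \<noteq> (0::'f::field)" and g: "g \<in> tuples n"
  shows "semisimple_algebra (corner_algebra (terwilliger_algebra TYPE('f) n U x) (dual_idem n U x g))"
proof -
  interpret mat_units X "TC :: (_ \<Rightarrow> _ \<Rightarrow> 'f) set" "tens (\<lambda>_. one_coef)" blocks block_index munit
    using val by (rule mat_units_terwilliger)
  have d: "dual_idem n U x g = (tens (\<lambda>h. shell_coef (g h)) :: _ \<Rightarrow> _ \<Rightarrow> 'f)"
    by (rule dual_idem_eq_tens)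
  have l: "lmul m (shell_coef (g h)) (unit_coef m w a c)
      = (if g h = 1 \<longleftrightarrow> w \<or> a \<noteq> 0 then unit_coef m w a c else (0, 0, 0, 0, 0))" 
    and r: "lmul m (unit_coef m w a c) (shell_coef (g h))
      = (if g h = 1 \<longleftrightarrow> w \<or> c \<noteq> 0 then unit_coef m w a c else (0, 0, 0, 0, 0))" for m :: 'f and w a c h
    by (auto simp: unit_coef_def)
  have ne: "\<exists>h\<in>{1..n}. \<not> (g h = 1 \<longleftrightarrow> h \<in> W \<or> i h \<noteq> 0)" if "W \<in> blocks" "i \<in> block_index W" "i \<noteq> g" for W i
  proof -
    have "i \<in> tuples n" using that by (simp add: block_index_def)
    then obtain h where "h \<in> {1..n}" "i h \<noteq> g h" using \<open>i \<noteq> g\<close> g tuples_eqI[of i g] by blast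
    then show ?thesis
      using that g tuples_D[of g h] tuples_D[of i h]
      by (intro bexI[of _ h]) (auto simp: block_index_def supp_def subset_iff)
  qed
  have eq: "g h = 1 \<longleftrightarrow> h \<in> W \<or> g h \<noteq> 0" if "g \<in> block_index W" "h \<in> {1..n}" for W h
    using that g tuples_D[of g h] by (auto simp: block_index_def supp_def)
  show ?thesis unfolding terwilliger_eq d
  proof (rule semisimple_corner[where B' = "{W \<in> blocks. g \<in> block_index W}" and s = g])
    fix W i j assume W: "W \<in> blocks" "i \<in> block_index W" "j \<in> block_index W"
    show "mmul X (tens (\<lambda>h. shell_coef (g h))) (munit W i j)
        = (if W \<in> {W \<in> blocks. g \<in> block_index W} \<and> i = g then munit W i j else (0 :: _ \<Rightarrow> _ \<Rightarrow> 'f))"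
    proof (cases "i = g")
      case True
      then show ?thesis unfolding munit_def tens_mult l using W eq by (auto intro!: tens_cong)
    next
      case False
      with ne W obtain h where "h \<in> {1..n}" "\<not> (g h = 1 \<longleftrightarrow> h \<in> W \<or> i h \<noteq> 0)" by blast
      with False show ?thesis unfolding munit_def tens_mult l by (subst tens_eq_zero[of h]) auto
    qed
    show "mmul X (munit W i j) (tens (\<lambda>h. shell_coef (g h)))
        = (if W \<in> {W \<in> blocks. g \<in> block_index W} \<and> j = g then munit W i j else (0 :: _ \<Rightarrow> _ \<Rightarrow> 'f))"
    proof (cases "j = g")
      case True
      then show ?thesis unfolding munit_def tens_mult r using W eq by (auto intro!: tens_cong)
    next
      case False
      with ne W obtain h where "h \<in> {1..n}" "\<not> (g h = 1 \<longleftrightarrow> h \<in> W \<or> j h \<noteq> 0)" by blast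
      with False show ?thesis unfolding munit_def tens_mult r by (subst tens_eq_zero[of h]) auto
    qed
  qed (auto intro: tens_in)
qed

section \<open>Blocks and equivalence classes of triples\<close>

definition triple_block :: "triple \<Rightarrow> nat set" where
  "triple_block = (\<lambda>(a, b, c). circ U (supp n a \<inter> supp n c) - supp n b)"

text \<open>When no valency vanishes, \<open>triples_D\<close> is all of \<open>triples_P\<close>,
  and these fibres are the equivalence classes.\<close>

definition block_class :: "nat set \<Rightarrow> triple set" where
  "block_class W = {t \<in> triples_P n U. triple_block t = W}"

lemma triples_D_eq:
  assumes val: "\<forall>h\<in>{1..n}. val h \<noteq> (0::'f::field)"
  shows "triples_D TYPE('f) n U = triples_P n U"
proof -
  have "of_nat (valency n U b) \<noteq> (0::'f)" for b
    using val by (auto simp: valency_def of_nat_prod val_def supp_def)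
  then show ?thesis by (auto simp: triples_D_def)
qed

lemma triple_block_in: "t \<in> triples_P n U \<Longrightarrow> triple_block t \<in> blocks"
  by (auto simp: triple_block_def blocks_def circ_def supp_def split_def)

lemma ex_triple:
  assumes W: "W \<in> blocks" and a: "a \<in> block_index W"
  shows "\<exists>b. (a, b, a) \<in> block_class W"
proof (rule exI)
  \<comment> \<open>For equal outer tuples the symmetric difference is empty, so the support of
    \<open>b\<close> may be any subset of \<open>circ U (supp n a)\<close>; removing
    \<open>W\<close> makes \<open>W\<close> the invariant.\<close>
  let ?b = "\<lambda>h\<in>{1..n}. if h \<in> circ U (supp n a) - W then 1 else 0 :: nat"
  have b: "supp n ?b = circ U (supp n a) - W" by (auto simp: supp_def circ_def)
  have "W \<subseteq> circ U (supp n a)" using assms by (auto simp: blocks_def circ_def block_index_def)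
  then show "(a, ?b, a) \<in> block_class W"
    unfolding block_class_def triples_P_def triple_block_def using a b
    by (auto simp: block_index_def tuples_def)
qed

lemma class_diag_block_class: "W \<in> blocks \<Longrightarrow> class_diag n (block_class W) = block_index W"
  using ex_triple
  by (auto simp: class_diag_def block_class_def block_index_def triple_block_def circ_def)

lemma bij_block_class:
  assumes val: "\<forall>h\<in>{1..n}. val h \<noteq> (0::'f::field)"
  shows "bij_betw block_class blocks (D_classes TYPE('f) n U)"
proof -
  have rel: "D_rel TYPE('f) n U `` {t} = block_class (triple_block t)" if "t \<in> triples_P n U" for t
    using that unfolding D_rel_def triples_D_eq[OF val] block_class_def triple_block_def
    by (auto simp: split_def)
  have ne: "block_class W \<noteq> {}" if "W \<in> blocks" for W
  proof -
    \<comment> \<open>The all-one tuple is an index of every block, so no fibre is empty and the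
      fibres determine their labels.\<close>
    have "(\<lambda>h\<in>{1..n}. 1) \<in> block_index W"
      using that by (auto simp: block_index_def tuples_def supp_def blocks_def circ_def)
    then show ?thesis using ex_triple[OF that] by blast
  qed
  have "inj_on block_class blocks"
  proof (rule inj_onI)
    fix W W' assume *: "W \<in> blocks" "W' \<in> blocks" "block_class W = block_class W'"
    then obtain t where "t \<in> block_class W" "t \<in> block_class W'" using ne by blast
    then show "W = W'" by (simp add: block_class_def)
  qed
  moreover have "block_class ` blocks = D_classes TYPE('f) n U"
  proof
    show "block_class ` blocks \<subseteq> D_classes TYPE('f) n U"
    proof
      fix C assume "C \<in> block_class ` blocks"
      then obtain W where W: "W \<in> blocks" "C = block_class W" by auto
      with ne obtain t where "t \<in> block_class W" by blast
      then have "t \<in> triples_P n U" "C = D_rel TYPE('f) n U `` {t}"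
        using rel W by (auto simp: block_class_def)
      then show "C \<in> D_classes TYPE('f) n U"
        unfolding D_classes_def triples_D_eq[OF val] by (auto intro: quotientI)
    qed
    show "D_classes TYPE('f) n U \<subseteq> block_class ` blocks"
      unfolding D_classes_def triples_D_eq[OF val] using rel triple_block_in by (auto elim!: quotientE)
  qed
  ultimately show ?thesis by (simp add: bij_betw_def)
qed

lemma terwilliger_iso:
  assumes val: "\<forall>h\<in>{1..n}. val h \<noteq> (0::'f::field)"
  shows "algebra_iso (terwilliger_algebra TYPE('f) n U x)
    (direct_sum_algebra (D_classes TYPE('f) n U) (\<lambda>C. mat_algebra {1..card (class_diag n C)}))"
proof -
  interpret mat_units X "TC :: (_ \<Rightarrow> _ \<Rightarrow> 'f) set" "tens (\<lambda>_. one_coef)" blocks block_index munit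
    using val by (rule mat_units_terwilliger)
  define \<phi> where "\<phi> = inv_into blocks block_class"
  have \<phi>: "bij_betw \<phi> (D_classes TYPE('f) n U) blocks"
    unfolding \<phi>_def by (rule bij_betw_inv_into[OF bij_block_class[OF val]])
  have "\<exists>\<eta>. bij_betw \<eta> {1..card (class_diag n C)} (block_index (\<phi> C))" if "C \<in> D_classes TYPE('f) n U" for C
  proof -
    have W: "\<phi> C \<in> blocks" using \<phi> that by (auto simp: bij_betw_def)
    have "block_class (\<phi> C) = C"
      unfolding \<phi>_def using that bij_block_class[OF val] by (intro f_inv_into_f) (simp add: bij_betw_def)
    then have "class_diag n C = block_index (\<phi> C)" using class_diag_block_class[OF W] by simp
    then show ?thesis using ex_bij_betw_nat_finite_1[OF fin_D[OF W]] by simp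
  qed
  then obtain \<eta> where "\<And>C. C \<in> D_classes TYPE('f) n U \<Longrightarrow>
      bij_betw (\<eta> C) {1..card (class_diag n C)} (block_index (\<phi> C))" by metis
  then interpret R: mat_units X "TC :: (_ \<Rightarrow> _ \<Rightarrow> 'f) set" "tens (\<lambda>_. one_coef)" "D_classes TYPE('f) n U"
      "\<lambda>C. {1..card (class_diag n C)}" "\<lambda>C i j. munit (\<phi> C) (\<eta> C i) (\<eta> C j)"
    by (rule reindex[OF \<phi>])
  show ?thesis unfolding terwilliger_eq by (rule R.iso_direct_sum)
qed

end

section \<open>The non-semisimple case\<close>

lemma underdetermined_system:
  fixes a :: "'k \<Rightarrow> 'j \<Rightarrow> 'f::field"
  assumes "finite K" "finite J" "card K < card J"
  shows "\<exists>c. (\<exists>j\<in>J. c j \<noteq> 0) \<and> (\<forall>k\<in>K. (\<Sum>j\<in>J. c j * a k j) = 0)"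
  using assms
proof (induction K arbitrary: J a rule: finite_induct)
  case empty
  then have "J \<noteq> {}" by auto
  then show ?case by (intro exI[of _ "\<lambda>_. 1"]) auto
next
  case (insert k K)
  show ?case
  proof (cases "\<forall>j\<in>J. a k j = 0")
    case True
    have "card K < card J" using insert by simp
    with insert obtain c where "\<exists>j\<in>J. c j \<noteq> 0" "\<forall>k\<in>K. (\<Sum>j\<in>J. c j * a k j) = 0" by blast
    with True show ?thesis by (intro exI[of _ c]) auto
  next
    case False
    then obtain i where i: "i \<in> J" "a k i \<noteq> 0" by blast
    define J' where "J' = J - {i}"
    have J': "finite J'" "card K < card J'" using insert i by (auto simp: J'_def)
    \<comment> \<open>Equation \<open>k\<close> is solved for the unknown \<open>i\<close> and
      substituted into the others, which yields these coefficients; \<open>d\<close> below restores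
      the eliminated unknown.\<close>
    obtain c where c: "\<exists>j\<in>J'. c j \<noteq> 0"
      "\<forall>l\<in>K. (\<Sum>j\<in>J'. c j * (a l j - a l i * a k j / a k i)) = 0"
      using insert.IH[OF J', of "\<lambda>l j. a l j - a l i * a k j / a k i"] by blast
    define d where "d j = (if j = i then - (\<Sum>j\<in>J'. c j * a k j) / a k i else c j)" for j
    have sum: "(\<Sum>j\<in>J. d j * a l j) = - (\<Sum>j\<in>J'. c j * a k j) / a k i * a l i + (\<Sum>j\<in>J'. c j * a l j)" for l
    proof -
      have "(\<Sum>j\<in>J. d j * a l j) = d i * a l i + (\<Sum>j\<in>J'. d j * a l j)"
        unfolding J'_def using insert.prems i by (intro sum.remove) auto
      also have "(\<Sum>j\<in>J'. d j * a l j) = (\<Sum>j\<in>J'. c j * a l j)"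
        by (intro sum.cong) (auto simp: d_def J'_def)
      finally show ?thesis by (simp add: d_def)
    qed
    have "(\<Sum>j\<in>J. d j * a l j) = 0" if "l \<in> K" for l
    proof -
      have "(\<Sum>j\<in>J'. c j * (a l j - a l i * a k j / a k i))
          = (\<Sum>j\<in>J'. c j * a l j - c j * a k j * (a l i / a k i))"
        by (intro sum.cong) (simp_all add: algebra_simps)
      also have "\<dots> = (\<Sum>j\<in>J'. c j * a l j) - (\<Sum>j\<in>J'. c j * a k j) * a l i / a k i"
        unfolding sum_subtractf sum_distrib_right[symmetric] by simp
      finally have "(\<Sum>j\<in>J'. c j * (a l j - a l i * a k j / a k i))
          = (\<Sum>j\<in>J'. c j * a l j) - (\<Sum>j\<in>J'. c j * a k j) * a l i / a k i" .
      with c that show ?thesis by (simp add: sum)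
    qed
    moreover have "(\<Sum>j\<in>J. d j * a k j) = 0" using i by (simp add: sum)
    moreover have "\<exists>j\<in>J. d j \<noteq> 0" using c(1) by (auto simp: d_def J'_def)
    ultimately show ?thesis by (intro exI[of _ d]) auto
  qed
qed

text \<open>The basis used at the critical coordinate: the all-one block replaces the off-diagonal
  orbital J - I, because J is nilpotent for \<open>m = 0\<close> and J - I is not.\<close>

definition block_coef :: "kind \<Rightarrow> 'f::field coef" where
  "block_coef k = (if k = K11 then (0, 0, 0, 1, 0) else kind_coef k)"

context factorial_scheme
begin

definition nil_elt :: "nat \<Rightarrow> (nat \<Rightarrow> 'u) \<Rightarrow> (nat \<Rightarrow> 'u) \<Rightarrow> 'f::field" where
  "nil_elt h = tens (\<lambda>k. if k = h then (0, 0, 0, 1, 0) else one_coef)"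

text \<open>For \<open>m = 0\<close>, multiplying \<open>(p, q, r, s, t)\<close> by the all-one
  block on either side gives \<open>(0, 0, 0, t, 0)\<close>.\<close>

lemma nil_central:
  assumes h: "val h = (0::'f::field)" and M: "M \<in> (TC :: (_ \<Rightarrow> _ \<Rightarrow> 'f) set)"
  shows "mmul X (nil_elt h) M = mmul X M (nil_elt h)"
proof -
  have "lmul (val k) (if k = h then (0, 0, 0, 1, 0) else one_coef) w
      = lmul (val k) w (if k = h then (0, 0, 0, 1, 0) else (one_coef :: 'f coef))" for k w
    using h by (cases w) auto
  then have "mmul X (nil_elt h) (tens v) = mmul X (tens v) (nil_elt h)" for v :: "nat \<Rightarrow> 'f coef"
    unfolding nil_elt_def tens_mult by simp
  then have "M \<in> {M. mmul X (nil_elt h) M = mmul X M (nil_elt h)}"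
    by (intro TC_induct[OF M]) (auto intro!: mat.subspaceI simp: mmul_linear)
  then show ?thesis by simp
qed

lemma nil_square:
  assumes "h \<in> {1..n}" "val h = (0::'f::field)"
  shows "mmul X (nil_elt h) (nil_elt h) = (0 :: _ \<Rightarrow> _ \<Rightarrow> 'f)"
  unfolding nil_elt_def tens_mult by (rule tens_eq_zero[OF assms(1)]) (simp add: assms(2))

text \<open>At a point that differs from the base point in every coordinate, the diagonal entry of
  the product is 1.\<close>

lemma nil_corner_nonzero:
  assumes "h \<in> {1..n}"
  shows "mmul X (nil_elt h) (dual_idem n U x (all_one n)) \<noteq> (0 :: _ \<Rightarrow> _ \<Rightarrow> 'f::field)"
proof -
  obtain y1 y2 where y1: "\<And>h. h \<in> {1..n} \<Longrightarrow> y1 h \<in> U h \<and> y1 h \<noteq> x h \<and> y2 h \<in> U h \<and> y2 h \<noteq> x h \<and>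
    (card (U h) > 2 \<longrightarrow> y1 h \<noteq> y2 h)" using ex_points by metis
  define y where "y = (\<lambda>h\<in>{1..n}. y1 h)"
  have y: "y \<in> X" using y1 by (auto simp: y_def points_def)
  have "local_mat (x k) (lmul (val k) (if k = h then (0, 0, 0, 1, 0) else one_coef)
      (shell_coef (all_one n k))) (y k) (y k) = (1 :: 'f)" if "k \<in> {1..n}" for k
    using y1[OF that] that by (cases "k = h") (simp_all add: y_def all_one_def)
  then have "tens (\<lambda>k. lmul (val k) (if k = h then (0, 0, 0, 1, 0) else one_coef)
      (shell_coef (all_one n k))) y y = (1 :: 'f)"
    unfolding tens_def using y by (simp del: shell_coef.simps)
  then have "mmul X (nil_elt h) (dual_idem n U x (all_one n)) y y = (1 :: 'f)"
    by (simp add: nil_elt_def dual_idem_eq_tens tens_mult)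
  then show ?thesis by (metis zero_fun_apply zero_neq_one)
qed

context
  fixes h :: nat
  assumes h: "h \<in> {1..n}" and val_h: "val h = (0::'f::field)"
begin

abbreviation "T \<equiv> terwilliger_algebra TYPE('f) n U x"

lemma nil_in: "nil_elt h \<in> TC"
  by (simp add: nil_elt_def tens_in)

lemma nil_nonzero: "nil_elt h \<noteq> (0 :: _ \<Rightarrow> _ \<Rightarrow> 'f)"
  using nil_corner_nonzero[OF h, where ?'f = 'f] by (auto simp: mmul_zero_left)

lemma not_semisimple: "\<not> semisimple_algebra T"
proof
  assume "semisimple_algebra T"
  from semisimple_algebra_central_square_zero[OF this, of "nil_elt h"] have "nil_elt h = (0 :: _ \<Rightarrow> _ \<Rightarrow> 'f)"
    unfolding terwilliger_eq sub_mat_simps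
    using nil_in nil_central[OF val_h] nil_square[OF h val_h] by blast
  with nil_nonzero show False by blast
qed

lemma not_semisimple_center: "\<not> semisimple_algebra (center_algebra T)"
proof
  have C: "center_algebra T = sub_mat X {z \<in> TC. \<forall>M\<in>TC. mmul X z M = mmul X M z} (tens (\<lambda>_. one_coef))"
    unfolding terwilliger_eq by (simp add: center_algebra_def sub_mat_def)
  assume "semisimple_algebra (center_algebra T)"
  from semisimple_algebra_central_square_zero[OF this, of "nil_elt h"] have "nil_elt h = (0 :: _ \<Rightarrow> _ \<Rightarrow> 'f)"
    unfolding C sub_mat_simps
    using nil_in nil_central[OF val_h] nil_square[OF h val_h] by blast
  with nil_nonzero show False by blast
qed

lemma not_semisimple_corner:
  "\<not> semisimple_algebra (corner_algebra T (dual_idem n U x (all_one n)))"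
proof
  define E where "E = (dual_idem n U x (all_one n) :: _ \<Rightarrow> _ \<Rightarrow> 'f)"
  define z where "z = mmul X (nil_elt h) E"
  have E: "E \<in> TC" by (simp add: E_def dual_idem_eq_tens tens_in)
  have EE: "mmul X E E = E"
    unfolding E_def dual_idem_eq_tens tens_mult by (rule tens_cong) (simp add: all_one_def)
  have EE': "mmul X E (mmul X E M) = mmul X E M" for M by (simp add: EE flip: mmul_assoc)
  have nil: "mmul X M (nil_elt h) = mmul X (nil_elt h) M"
    "mmul X M (mmul X (nil_elt h) N) = mmul X (nil_elt h) (mmul X M N)" if "M \<in> TC" for M N :: "_ \<Rightarrow> _ \<Rightarrow> 'f"
    using nil_central[OF val_h that] by (simp_all flip: mmul_assoc)
  have z: "z = mmul X (mmul X E (nil_elt h)) E" using nil[OF E] EE by (simp add: z_def mmul_assoc)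
  assume ss: "semisimple_algebra (corner_algebra T (dual_idem n U x (all_one n)))"
  have C: "corner_algebra T (dual_idem n U x (all_one n)) = sub_mat X {mmul X (mmul X E M) E | M. M \<in> TC} E"
    unfolding terwilliger_eq by (simp add: corner_algebra_def E_def sub_mat_def)
  have "z = 0"
  proof (rule semisimple_algebra_central_square_zero[OF ss, unfolded C sub_mat_simps])
    show "z \<in> {mmul X (mmul X E M) E | M. M \<in> TC}" using z nil_in by blast
    show "mmul X z z = 0"
      using nil(2)[OF E] nil_square[OF h val_h]
      by (simp add: z_def mmul_assoc EE) (simp add: mmul_zero_left flip: mmul_assoc)
    fix a assume "a \<in> {mmul X (mmul X E M) E | M. M \<in> TC}"
    then obtain M where M: "M \<in> TC" "a = mmul X (mmul X E M) E" by blast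
    then have a: "a \<in> TC" "mmul X E a = a" "mmul X a E = a"
      using E TC_mult EE by (auto simp: mmul_assoc EE')
    have "mmul X z a = mmul X (nil_elt h) a" by (simp add: z_def mmul_assoc a)
    also have "\<dots> = mmul X a z" by (simp add: z_def nil(2)[OF a(1)] a)
    finally show "mmul X z a = mmul X a z" .
  qed
  then show False using nil_corner_nonzero[OF h, where ?'f = 'f] by (simp add: z_def E_def)
qed

text \<open>Every direct sum of full matrix algebras is excluded, which covers the one in the
  theorem without computing its classes when valencies vanish.\<close>

lemma not_iso:
  "\<not> algebra_iso T (direct_sum_algebra I (\<lambda>i. mat_algebra {1..d i} :: ('f, nat \<Rightarrow> nat \<Rightarrow> 'f) module))"
proof
  assume "algebra_iso T (direct_sum_algebra I (\<lambda>i. mat_algebra {1..d i} :: ('f, nat \<Rightarrow> nat \<Rightarrow> 'f) module))"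
  then obtain \<phi> where \<phi>: "\<phi> \<in> ring_iso T (direct_sum_algebra I (\<lambda>i. mat_algebra {1..d i} :: ('f, nat \<Rightarrow> nat \<Rightarrow> 'f) module))"
    by (auto simp: algebra_iso_def)
  have "assoc_algebra T"
    unfolding terwilliger_eq by (intro assoc_algebra_sub_mat subspace_TC tens_in TC_mult TC_one)
  then have "ring T" by (simp add: assoc_algebra_def)
  then have "nil_elt h = \<zero>\<^bsub>T\<^esub>"
    by (rule ring_iso_direct_sum_mat_central_square_zero[OF \<phi>])
      (use nil_in nil_central[OF val_h] nil_square[OF h val_h] in \<open>auto simp: terwilliger_eq\<close>)
  with nil_nonzero show False by (simp add: terwilliger_eq)
qed

text \<open>
  In a Frobenius algebra the annihilator of a subspace \<open>W\<close> has codimension \<open>dim W\<close>.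
  Here the tensors with \<open>K10\<close> or \<open>K11\<close> at \<open>h\<close> are all annihilated from the left by
  the tensors without \<open>KE\<close> at \<open>h\<close>, whose span has only half the required codimension.
\<close>

lemma not_frobenius: "\<not> frobenius_algebra T"
proof
  assume "frobenius_algebra T"
  then obtain \<beta> where "bilinear_form T \<beta>" "nondegenerate_form T \<beta>" "associative_form T \<beta>"
    by (auto simp: frobenius_algebra_def)
  then have add: "\<And>M N P. \<lbrakk>M \<in> TC; N \<in> TC; P \<in> TC\<rbrakk> \<Longrightarrow> \<beta> (M + N) P = \<beta> M P + \<beta> N P"
    and add': "\<And>M N P. \<lbrakk>M \<in> TC; N \<in> TC; P \<in> TC\<rbrakk> \<Longrightarrow> \<beta> P (M + N) = \<beta> P M + \<beta> P N"
    and scale: "\<And>c M N. \<lbrakk>M \<in> TC; N \<in> TC\<rbrakk> \<Longrightarrow> \<beta> (mscale c M) N = c * \<beta> M N"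
    and scale': "\<And>c M N. \<lbrakk>M \<in> TC; N \<in> TC\<rbrakk> \<Longrightarrow> \<beta> M (mscale c N) = c * \<beta> M N"
    and nondeg: "\<And>N. \<lbrakk>N \<in> TC; \<forall>M\<in>TC. \<beta> M N = 0\<rbrakk> \<Longrightarrow> N = 0"
    and assoc: "\<And>M N P. \<lbrakk>M \<in> TC; N \<in> TC; P \<in> TC\<rbrakk> \<Longrightarrow> \<beta> (mmul X M N) P = \<beta> M (mmul X N P)"
    unfolding bilinear_form_def nondegenerate_form_def associative_form_def terwilliger_eq sub_mat_simps
    by blast+
  \<comment> \<open>For two points \<open>m\<close> would be 1. Hence \<open>K11\<close> is
    available at \<open>h\<close>, which makes \<open>J\<close> larger than \<open>K\<close>
    below.\<close>
  have card_h: "card (U h) > 2"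
    using val_h card_U[OF h] by (cases "card (U h) = 2") (auto simp: val_def)
  define I where "I k = {K00, K01, K10, KE} \<union> (if card (U k) > 2 then {K11} else {})" for k
  \<comment> \<open>\<open>P\<close> indexes tensors spanning \<open>TC\<close>. Those in
    \<open>J\<close> span the space to be annihilated, and only those in \<open>K\<close> can fail
    to annihilate it from the left.\<close>
  define P where "P = PiE {1..n} I"
  define J where "J = {j \<in> P. j h \<in> {K10, K11}}"
  define K where "K = {j \<in> P. j h = KE}"
  define co :: "nat \<Rightarrow> kind \<Rightarrow> 'f coef" where "co k i = (if k = h then block_coef i else kind_coef i)" for k i
  define w where "w j = tens (\<lambda>k. co k (j k))" for j
  have wT: "w j \<in> TC" for j by (simp add: w_def tens_in)
  have finP: "finite P" unfolding P_def by (intro finite_PiE) (auto simp: I_def)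
  have ann: "mmul X (w i) (w j) = 0" if "i h \<noteq> KE" "j \<in> J" for i j
  proof -
    have "lmul (val h) (co h (i h)) (co h (j h)) = (0, 0, 0, 0, 0)"
      using that val_h by (cases "i h") (auto simp: co_def block_coef_def J_def)
    then show ?thesis unfolding w_def tens_mult by (rule tens_eq_zero[OF h])
  qed
  have "card K < card J"
  proof -
    have upd: "j(h := k) \<in> P" if "j \<in> P" for j k
      using that h card_h unfolding P_def I_def by (cases k) (auto simp: PiE_iff extensional_def)
    \<comment> \<open>Replacing \<open>KE\<close> by \<open>K10\<close> at \<open>h\<close> embeds
      \<open>K\<close> into \<open>J\<close> and misses the indices with \<open>K11\<close>
      there.\<close>
    have "inj_on (\<lambda>j. j(h := K10)) K"
    proof (rule inj_onI)
      fix i j assume "i \<in> K" "j \<in> K" "i(h := K10) = j(h := K10)"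
      then show "i = j" by (auto simp: K_def fun_eq_iff split: if_splits) (metis fun_upd_apply)
    qed
    then have "card K = card ((\<lambda>j. j(h := K10)) ` K)" by (simp add: card_image)
    also have "\<dots> < card J"
    proof (rule psubset_card_mono)
      show "finite J" using finP by (simp add: J_def)
      have "(\<lambda>k\<in>{1..n}. K00) \<in> P" by (auto simp: P_def I_def)
      then have "(\<lambda>k\<in>{1..n}. K00)(h := K11) \<in> J" using upd by (simp add: J_def)
      moreover have "(\<lambda>k\<in>{1..n}. K00)(h := K11) \<notin> (\<lambda>j. j(h := K10)) ` K"
        by (auto dest!: fun_cong[of _ _ h])
      moreover have "(\<lambda>j. j(h := K10)) ` K \<subseteq> J" using upd by (auto simp: J_def K_def)
      ultimately show "(\<lambda>j. j(h := K10)) ` K \<subset> J" by blast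
    qed
    finally show ?thesis .
  qed
  then obtain c where c: "\<exists>j\<in>J. c j \<noteq> 0" "\<forall>k\<in>K. (\<Sum>j\<in>J. c j * \<beta> (w k) (w j)) = 0"
    using underdetermined_system[of K J "\<lambda>k j. \<beta> (w k) (w j)"] finP by (auto simp: J_def K_def)
  define W where "W = (\<Sum>j\<in>J. mscale (c j) (w j))"
  have WT: "W \<in> TC" unfolding W_def by (intro mat.subspace_sum mat.subspace_scale subspace_TC wT)
  have zero: "\<beta> M 0 = 0" "\<beta> 0 M = 0" if "M \<in> TC" for M
    using scale'[OF that that, of 0] scale[OF that that, of 0] by simp_all
  have \<beta>W: "\<beta> M W = (\<Sum>j\<in>J. c j * \<beta> M (w j))" if M: "M \<in> TC" for M
  proof -
    have "finite J" using finP by (simp add: J_def)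
    then show ?thesis unfolding W_def
    proof (induction J rule: finite_induct)
      case (insert j J)
      have "(\<Sum>j\<in>J. mscale (c j) (w j)) \<in> TC"
        by (intro mat.subspace_sum mat.subspace_scale subspace_TC wT)
      then have "\<beta> M (mscale (c j) (w j) + (\<Sum>j\<in>J. mscale (c j) (w j)))
          = c j * \<beta> M (w j) + \<beta> M (\<Sum>j\<in>J. mscale (c j) (w j))"
        using add'[OF mat.subspace_scale[OF subspace_TC wT] _ M] scale'[OF M wT] by presburger
      with insert.IH show ?case by (simp only: sum.insert[OF insert.hyps])
    qed (simp only: sum.empty zero[OF M])
  qed
  have rad: "\<beta> M W = 0" if "M \<in> TC" for M
  proof -
    define S where "S = {M \<in> TC. \<beta> M W = 0}"
    have S: "mat.subspace S"
      by (rule mat.subspaceI)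
        (auto simp: S_def zero WT add scale mat.subspace_0[OF subspace_TC] mat.subspace_add[OF subspace_TC]
          mat.subspace_scale[OF subspace_TC])
    have wS: "w j \<in> S" if "j \<in> P" for j
    proof (cases "j h = KE")
      case True
      with c(2) that have "(\<Sum>i\<in>J. c i * \<beta> (w j) (w i)) = 0" by (simp add: K_def)
      then show ?thesis by (simp add: S_def wT \<beta>W)
    next
      case False
      \<comment> \<open>By associativity, the form at \<open>w j\<close> and \<open>W\<close> equals
        the form at the identity and this product. For indices in \<open>K\<close> the form vanishes
        instead by the choice of \<open>c\<close>, so \<open>W\<close> lies in the radical.\<close>
      have "mmul X (w j) W = 0"
        unfolding W_def mmul_linear using False by (intro sum.neutral) (simp add: ann)
      then have "\<beta> (mmul X (tens (\<lambda>_. one_coef)) (w j)) W = 0"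
        using zero(1)[OF tens_in] by (simp only: assoc[OF tens_in wT WT])
      then show ?thesis by (simp add: S_def wT TC_one(1))
    qed
    have "tens v \<in> S" for v :: "nat \<Rightarrow> 'f coef"
    proof -
      \<comment> \<open>With the all-one block in place of J - I at \<open>h\<close>, the identity
        part has coefficient \<open>t\<close> rather than the diagonal value
        \<open>s + t\<close>.\<close>
      define d where "d k i = (if k = h \<and> i = KE then case v h of (p, q, r, s, t) \<Rightarrow> t else kind_val (v k) i)" for k i
      have "tens v = (\<Sum>j\<in>PiE {1..n} I. mscale (\<Prod>k\<in>{1..n}. d k (j k)) (tens (\<lambda>k. co k (j k))))"
      proof (rule tens_expand)
        show "finite (I k)" for k by (simp add: I_def)
        fix k y z assume k: "k \<in> {1..n}" and yz: "y \<in> U k" "z \<in> U k"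
        obtain p q r s t where v: "v k = (p, q, r, s, t)" by (metis prod_cases5)
        have Ik: "(\<Sum>i\<in>I k. F i) = F K00 + F K01 + F K10 + F KE + (if card (U k) > 2 then F K11 else 0)"
          for F :: "_ \<Rightarrow> 'f" by (simp add: I_def add.assoc)
        consider "k = h" | "k \<noteq> h" "card (U k) > 2" | "k \<noteq> h" "\<not> card (U k) > 2" by blast
        then show "local_mat (x k) (v k) y z = (\<Sum>i\<in>I k. d k i * local_mat (x k) (co k i) y z)"
        proof cases
          case 1 then show ?thesis unfolding Ik using card_h v by (simp add: d_def co_def block_coef_def)
        next
          case 2 then show ?thesis unfolding Ik using v by (simp add: d_def co_def)
        next
          case 3 then show ?thesis unfolding Ik using v two_points[OF k 3(2) yz]
            by (cases "y = x k"; cases "z = x k") (simp_all add: d_def co_def)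
        qed
      qed
      also have "\<dots> \<in> S"
        using wS by (intro mat.subspace_sum mat.subspace_scale S) (simp add: P_def w_def)
      finally show ?thesis .
    qed
    then have "M \<in> S" by (rule TC_induct[OF that S])
    then show ?thesis by (simp add: S_def)
  qed
  obtain y1 y2 where y12: "\<And>h. h \<in> {1..n} \<Longrightarrow> y1 h \<in> U h \<and> y1 h \<noteq> x h \<and> y2 h \<in> U h \<and> y2 h \<noteq> x h \<and>
    (card (U h) > 2 \<longrightarrow> y1 h \<noteq> y2 h)" using ex_points by metis
  obtain j where j: "j \<in> J" "c j \<noteq> 0" using c(1) by blast
  \<comment> \<open>The pair \<open>(y, z)\<close> has kind \<open>j k\<close> in every coordinate
    \<open>k\<close>, so among the tensors of \<open>J\<close> only \<open>w j\<close> is nonzero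
    there; the entry of \<open>W\<close> at this pair is \<open>c j\<close>.\<close>
  define y where "y = (\<lambda>k\<in>{1..n}. if j k \<in> {K00, K01} then x k else y1 k)"
  define z where "z = (\<lambda>k\<in>{1..n}. if j k \<in> {K00, K10} then x k else if j k = K11 then y2 k else y1 k)"
  have yz: "y \<in> X" "z \<in> X" using y12 X_D[OF x_in] by (auto simp: y_def z_def points_def)
  have wi: "w i y z = (if i = j then 1 else 0)" if i: "i \<in> J" for i
  proof -
    have "local_mat (x k) (co k (i k)) (y k) (z k) = (if i k = j k then 1 else 0)" if k: "k \<in> {1..n}" for k
    proof -
      have "j k \<in> I k" using j k by (auto simp: J_def P_def)
      then have "j k = K11 \<Longrightarrow> y1 k \<noteq> y2 k" using y12[OF k] by (auto simp: I_def split: if_splits)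
      \<comment> \<open>The all-one block used at \<open>h\<close> is nonzero on \<open>KE\<close>
        as well as \<open>K11\<close>, but the test pair has kind \<open>K10\<close> or
        \<open>K11\<close> at \<open>h\<close>, so no confusion arises.\<close>
      moreover have "k = h \<Longrightarrow> i k \<in> {K10, K11} \<and> j k \<in> {K10, K11}" using i j by (auto simp: J_def)
      ultimately show ?thesis using y12[OF k] k
        by (cases "j k"; cases "i k"; cases "k = h") (simp_all add: co_def block_coef_def y_def z_def)
    qed
    then have "w i y z = (if \<forall>k\<in>{1..n}. i k = j k then 1 else 0)"
      using yz by (simp add: w_def tens_def flip: prod_indicator)
    moreover have "(\<forall>k\<in>{1..n}. i k = j k) \<longleftrightarrow> i = j"
      using i j by (auto simp: J_def P_def intro: PiE_ext)
    ultimately show ?thesis by simp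
  qed
  have "W y z = (\<Sum>i\<in>J. if i = j then c j else 0)"
    unfolding W_def sum_fun_apply2 mscale_apply by (intro sum.cong) (auto simp: wi)
  also have "\<dots> = c j" using j finP by (simp add: J_def sum.delta)
  finally have "W y z \<noteq> 0" using j by simp
  moreover have "W = 0" using nondeg[OF WT] rad by blast
  ultimately show False by simp
qed

end

end

theorem theorem8p18:
  fixes n :: nat and U :: "nat \<Rightarrow> 'u set" and x :: "nat \<Rightarrow> 'u"
  assumes "n \<ge> 1"
    and "\<forall>h \<in> {1..n}. finite (U h) \<and> card (U h) \<ge> 2"
    and "x \<in> points n U"
  shows
    "((\<forall>g \<in> tuples n. (of_nat (valency n U g) :: 'f::field) \<noteq> 0) \<longleftrightarrow>
        semisimple_algebra (terwilliger_algebra TYPE('f) n U x)) \<and>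
     (semisimple_algebra (terwilliger_algebra TYPE('f) n U x) \<longleftrightarrow>
        (\<forall>g \<in> tuples n.
           semisimple_algebra (corner_algebra (terwilliger_algebra TYPE('f) n U x) (dual_idem n U x g)))) \<and>
     ((\<forall>g \<in> tuples n.
         semisimple_algebra (corner_algebra (terwilliger_algebra TYPE('f) n U x) (dual_idem n U x g))) \<longleftrightarrow>
        semisimple_algebra
          (corner_algebra (terwilliger_algebra TYPE('f) n U x) (dual_idem n U x (all_one n)))) \<and>
     (semisimple_algebra
        (corner_algebra (terwilliger_algebra TYPE('f) n U x) (dual_idem n U x (all_one n))) \<longleftrightarrow>
        semisimple_algebra (center_algebra (terwilliger_algebra TYPE('f) n U x))) \<and>
     (semisimple_algebra (center_algebra (terwilliger_algebra TYPE('f) n U x)) \<longleftrightarrow>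
        symmetric_algebra (terwilliger_algebra TYPE('f) n U x)) \<and>
     (symmetric_algebra (terwilliger_algebra TYPE('f) n U x) \<longleftrightarrow>
        frobenius_algebra (terwilliger_algebra TYPE('f) n U x)) \<and>
     (frobenius_algebra (terwilliger_algebra TYPE('f) n U x) \<longleftrightarrow>
        algebra_iso (terwilliger_algebra TYPE('f) n U x)
          (direct_sum_algebra (D_classes TYPE('f) n U)
             (\<lambda>C. mat_algebra {1..card (class_diag n C)}))) \<and>
     (algebra_iso (terwilliger_algebra TYPE('f) n U x)
        (direct_sum_algebra (D_classes TYPE('f) n U)
           (\<lambda>C. mat_algebra {1..card (class_diag n C)})) \<longleftrightarrow>
        (of_nat (\<Prod>h = 1..n. card (U h) - 1) :: 'f) \<noteq> 0)"
proof -
  interpret factorial_scheme n U x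
    using assms by unfold_locales auto
  \<comment> \<open>One arithmetic condition decides everything: under it each listed property
    holds, without it each fails, and the chain of equivalences is then propositional.\<close>
  let ?K = "\<forall>h\<in>{1..n}. val h \<noteq> (0::'f)"
  let ?T = "terwilliger_algebra TYPE('f) n U x"
  have valency: "(\<forall>g\<in>tuples n. (of_nat (valency n U g) :: 'f) \<noteq> 0) \<longleftrightarrow> ?K"
  proof
    assume "\<forall>g\<in>tuples n. (of_nat (valency n U g) :: 'f) \<noteq> 0"
    \<comment> \<open>The valency of the all-one tuple is the full product, so its nonvanishing
      already gives every factor.\<close>
    moreover have "all_one n \<in> tuples n" "supp n (all_one n) = {1..n}"
      by (auto simp: all_one_def tuples_def supp_def)
    ultimately have "of_nat (\<Prod>h\<in>{1..n}. card (U h) - 1) \<noteq> (0::'f)"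
      by (auto simp: valency_def)
    then show ?K by (auto simp: of_nat_prod val_def)
  qed (auto simp: valency_def of_nat_prod val_def supp_def)
  have prod: "(of_nat (\<Prod>h = 1..n. card (U h) - 1) :: 'f) \<noteq> 0 \<longleftrightarrow> ?K"
    by (auto simp: of_nat_prod val_def)
  have one: "all_one n \<in> tuples n"
    by (auto simp: all_one_def tuples_def)
  show ?thesis
  proof (cases ?K)
    case True
    interpret mat_units X "TC :: (_ \<Rightarrow> _ \<Rightarrow> 'f) set" "tens (\<lambda>_. one_coef)" blocks block_index munit
      using True by (rule mat_units_terwilliger)
    have "semisimple_algebra ?T" "semisimple_algebra (center_algebra ?T)" "symmetric_algebra ?T"
      unfolding terwilliger_eq by (rule semisimple semisimple_center symmetric)+
    moreover from \<open>symmetric_algebra ?T\<close> have "frobenius_algebra ?T"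
      by (auto simp: symmetric_algebra_def frobenius_algebra_def)
    ultimately show ?thesis
      using True valency prod one semisimple_corner_terwilliger[OF True] terwilliger_iso[OF True] by blast
  next
    case False
    then obtain h where h: "h \<in> {1..n}" "val h = (0::'f)" by blast
    have "\<not> symmetric_algebra ?T"
      using not_frobenius[OF h] by (auto simp: symmetric_algebra_def frobenius_algebra_def)
    moreover have "\<not> (\<forall>g\<in>tuples n. semisimple_algebra (corner_algebra ?T (dual_idem n U x g)))"
      using one not_semisimple_corner[OF h] by blast
    ultimately show ?thesis
      using False valency prod not_semisimple[OF h] not_semisimple_center[OF h]
        not_semisimple_corner[OF h] not_frobenius[OF h]
        not_iso[OF h, of "D_classes TYPE('f) n U" "\<lambda>C. card (class_diag n C)"] by (simp only: simp_thms)
  qed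
qed

end
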